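(* Let $q\ge1$, $\mathcal{Y}_1=\mathcal{Y}_2=\mathbb{R}$, $\mathcal{X}=\mathbb{R}^q$, and let $\mu_{\ell3}=\mathrm{Law}(Y_\ell,X)\in\mathcal{P}(\mathbb{R}\times\mathbb{R}^q)$, $\ell=1,2$, have the same projection on $\mathbb{R}^q$. Assume $\mathbb{E}\|X\|_2^2<\infty$, $\mathbb{E}|Y_1|^2<\infty$ and $\mathbb{E}|Y_2|^2<\infty$. For $\ell=1,2$ let $V_\ell=\begin{pmatrix} V_{\ell,YY} & V_{\ell,YX} \\ V_{\ell,XY} & V_{\ell,XX} \end{pmatrix}$ be a positive definite $(1+q)\times(1+q)$ matrix. Let $f(y_1,y_2)=y_2-y_1$. Let $\mathcal{I}$ be the primal of the overlapping W-DMR problem under the costs $c_\ell(s_\ell,s_\ell')=(s_\ell-s_\ell')^\top V_\ell^{-1}(s_\ell-s_\ell')$, and let $\mathcal{I}_{\mathrm{D}}$ be the primal of the non-overlapping W-DMR problem under the costs $c_{Y_\ell}(y_\ell,y_\ell')=(y_\ell-y_\ell')^\top V_{\ell,YY}^{-1}(y_\ell-y_\ell')$. Then: (i) for all $\delta\in\mathbb{R}_+^2$, $$\mathcal{I}_{\mathrm{D}}(\delta)=\mathbb{E}[Y_2]-\mathbb{E}[Y_1]+V_{1,YY}^{1/2}\delta_1^{1/2}+V_{2,YY}^{1/2}\delta_2^{1/2},$$ $$\mathcal{I}(\delta)=\mathbb{E}[Y_2]-\mathbb{E}[Y_1]+\inf_{\lambda\in\mathbb{R}_{++}^2}\left\{\lambda_1\delta_1+\lambda_2\delta_2+\frac{1}{4\lambda_1}(V_1/V_{1,XX})+\frac{1}{4\lambda_2}(V_2/V_{2,XX})+\frac14V_o^\top\left(\lambda_1V_{1,XX}^{-1}+\lambda_2V_{2,XX}^{-1}\right)^{-1}V_o\right\},$$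 where $V_\ell/V_{\ell,XX}=V_{\ell,YY}-V_{\ell,YX}V_{\ell,XX}^{-1}V_{\ell,XY}$ is the Schur complement of $V_{\ell,XX}$ in $V_\ell$ for $\ell=1,2$, and $V_o=V_{2,XX}^{-1}V_{2,XY}-V_{1,XX}^{-1}V_{1,XY}$; (ii) $\mathcal{I}_{\mathrm{D}}(\delta)=\mathcal{I}(\delta)$ for all $\delta\in\mathbb{R}_+^2$ if and only if $V_{1,XY}=V_{2,XY}=0$; (iii) $\mathcal{I}_{\mathrm{D}}(\delta)$ and $\mathcal{I}(\delta)$ are continuous on $\mathbb{R}_+^2$.
   Context: $\mathcal{P}(\cdot)$ denotes Borel probability measures, $\Pi(\mu,\nu)$ couplings; $\mathbb{R}_+^2$ ($\mathbb{R}_{++}^2$) is the set of vectors with nonnegative (strictly positive) coordinates; $s_\ell=(y_\ell,x_\ell)\in\mathbb{R}\times\mathbb{R}^q$. Expectations $\mathbb{E}$ of $X,Y_1,Y_2$ are under $\mu_{13},\mu_{23}$. $\mathcal{I}(\delta)=\sup_{\gamma\in\Sigma(\delta)}\int f(y_1,y_2)\,d\gamma(y_1,y_2,x)$ with $\Sigma(\delta)=\{\gamma\in\mathcal{P}(\mathbb{R}\times\mathbb{R}\times\mathbb{R}^q):\boldsymbol{K}_\ell(\mu_{\ell3},\gamma_{\ell3})\le\delta_\ell,\ \ell=1,2\}$, where $\gamma_{\ell3}$ is the law of $(y_\ell,x)$ under $\gamma$ and $\boldsymbol{K}_\ell(\mu,\nu)=\inf_{\pi\in\Pi(\mu,\nu)}\int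 c_\ell\,d\pi$. $\mathcal{I}_{\mathrm{D}}(\delta)=\sup_{\gamma\in\Sigma_{\mathrm{D}}(\delta)}\int f\,d\gamma$ with $\Sigma_{\mathrm{D}}(\delta)=\{\gamma\in\mathcal{P}(\mathbb{R}\times\mathbb{R}):\boldsymbol{K}_{Y_\ell}(\mu_{Y_\ell},\gamma_\ell)\le\delta_\ell,\ \ell=1,2\}$, where $\mu_{Y_\ell}=\mathrm{Law}(Y_\ell)$, $\gamma_\ell$ is the $\ell$-th marginal of $\gamma$ and $\boldsymbol{K}_{Y_\ell}(\mu,\nu)=\inf_{\pi\in\Pi(\mu,\nu)}\int c_{Y_\ell}\,d\pi$. *)

theory Defs
  imports "HOL-Probability.Probability"
begin

section \<open>Optimal transport costs and the W-DMR problems\<close>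

definition borel_probs :: "'a::topological_space measure set" where
  "borel_probs = {\<mu>. prob_space \<mu> \<and> sets \<mu> = sets borel}"

definition couplings ::
  "'a::second_countable_topology measure \<Rightarrow> 'b::second_countable_topology measure \<Rightarrow> ('a \<times> 'b) measure set" where
  "couplings \<mu> \<nu> = {\<pi> \<in> borel_probs. distr \<pi> borel fst = \<mu> \<and> distr \<pi> borel snd = \<nu>}"

text \<open>Costs are assumed nonnegative: \<^const>\<open>ennreal\<close> truncates negative values to \<open>0\<close>.\<close>

definition transport_cost ::
  "('a::second_countable_topology \<Rightarrow> 'a \<Rightarrow> real) \<Rightarrow> 'a measure \<Rightarrow> 'a measure \<Rightarrow> ennreal" where
  "transport_cost c \<mu> \<nu> = (INF \<pi>\<in>couplings \<mu> \<nu>. \<integral>\<^sup>+ z. ennreal (c (fst z) (snd z)) \<partial>\<pi>)"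

text \<open>
  The integral with values in \<open>[-\<infinity>, \<infinity>]\<close>, so that suprema of integrals are not affected by the
  convention that the Bochner integral of a non-integrable function is \<open>0\<close>. If the positive and
  the negative part both have infinite integral, the value is \<open>\<infinity> - \<infinity> = \<infinity>\<close>; for the objective
  \<open>y\<^sub>2 - y\<^sub>1\<close>, quadratic costs and reference measures with second moments, every feasible measure
  makes the objective integrable.
\<close>

definition ext_integral :: "'a measure \<Rightarrow> ('a \<Rightarrow> real) \<Rightarrow> ereal" where
  "ext_integral M g =
     enn2ereal (\<integral>\<^sup>+ z. ennreal (g z) \<partial>M) - enn2ereal (\<integral>\<^sup>+ z. ennreal (- g z) \<partial>M)"

lemma ext_integral_eq_lebesgue_integral:
  assumes "integrable M g"
  shows "ext_integral M g = ereal (\<integral>z. g z \<partial>M)"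
proof -
  let ?P = "\<integral>\<^sup>+ z. ennreal (g z) \<partial>M" and ?N = "\<integral>\<^sup>+ z. ennreal (- g z) \<partial>M"
  have "?P < top" "?N < top"
    using assms by (auto simp: real_integrable_def less_top)
  then obtain a b where "?P = ennreal a" "0 \<le> a" "?N = ennreal b" "0 \<le> b"
    by (cases ?P; cases ?N) auto
  then show ?thesis
    using assms by (simp add: ext_integral_def real_lebesgue_integral_def enn2ereal_ennreal)
qed

text \<open>
  Points of the overlapping problem are triples \<open>(y\<^sub>1, y\<^sub>2, x)\<close>; the reference measures are laws of
  \<open>(y\<^sub>1, x)\<close> and \<open>(y\<^sub>2, x)\<close>. The radius \<open>\<delta>\<close> is a pair \<open>(\<delta>\<^sub>1, \<delta>\<^sub>2)\<close> with nonnegative components.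
\<close>

definition overlap_ambiguity ::
  "('a \<times> 'c \<Rightarrow> 'a \<times> 'c \<Rightarrow> real) \<Rightarrow> ('b \<times> 'c \<Rightarrow> 'b \<times> 'c \<Rightarrow> real) \<Rightarrow>
   ('a \<times> 'c) measure \<Rightarrow> ('b \<times> 'c) measure \<Rightarrow> real \<times> real \<Rightarrow>
   ('a::second_countable_topology \<times> 'b::second_countable_topology \<times> 'c::second_countable_topology) measure set" where
  "overlap_ambiguity c1 c2 \<mu>13 \<mu>23 \<delta> = {\<gamma> \<in> borel_probs.
     transport_cost c1 \<mu>13 (distr \<gamma> borel (\<lambda>(y1, y2, x). (y1, x))) \<le> ennreal (fst \<delta>) \<and>
     transport_cost c2 \<mu>23 (distr \<gamma> borel (\<lambda>(y1, y2, x). (y2, x))) \<le> ennreal (snd \<delta>)}"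

definition overlap_primal ::
  "('a \<Rightarrow> 'b \<Rightarrow> real) \<Rightarrow>
   ('a \<times> 'c \<Rightarrow> 'a \<times> 'c \<Rightarrow> real) \<Rightarrow> ('b \<times> 'c \<Rightarrow> 'b \<times> 'c \<Rightarrow> real) \<Rightarrow>
   ('a::second_countable_topology \<times> 'c::second_countable_topology) measure \<Rightarrow> ('b::second_countable_topology \<times> 'c) measure \<Rightarrow>
   real \<times> real \<Rightarrow> ereal" where
  "overlap_primal f c1 c2 \<mu>13 \<mu>23 \<delta> =
     (SUP \<gamma>\<in>overlap_ambiguity c1 c2 \<mu>13 \<mu>23 \<delta>. ext_integral \<gamma> (\<lambda>(y1, y2, x). f y1 y2))"

definition nonoverlap_ambiguity ::
  "('a \<Rightarrow> 'a \<Rightarrow> real) \<Rightarrow> ('b \<Rightarrow> 'b \<Rightarrow> real) \<Rightarrow>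
   'a measure \<Rightarrow> 'b measure \<Rightarrow> real \<times> real \<Rightarrow> ('a::second_countable_topology \<times> 'b::second_countable_topology) measure set" where
  "nonoverlap_ambiguity c1 c2 \<mu>1 \<mu>2 \<delta> = {\<gamma> \<in> borel_probs.
     transport_cost c1 \<mu>1 (distr \<gamma> borel fst) \<le> ennreal (fst \<delta>) \<and>
     transport_cost c2 \<mu>2 (distr \<gamma> borel snd) \<le> ennreal (snd \<delta>)}"

definition nonoverlap_primal ::
  "('a \<Rightarrow> 'b \<Rightarrow> real) \<Rightarrow> ('a \<Rightarrow> 'a \<Rightarrow> real) \<Rightarrow> ('b \<Rightarrow> 'b \<Rightarrow> real) \<Rightarrow>
   'a::second_countable_topology measure \<Rightarrow> 'b::second_countable_topology measure \<Rightarrow> real \<times> real \<Rightarrow> ereal" where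
  "nonoverlap_primal f c1 c2 \<mu>1 \<mu>2 \<delta> =
     (SUP \<gamma>\<in>nonoverlap_ambiguity c1 c2 \<mu>1 \<mu>2 \<delta>. ext_integral \<gamma> (\<lambda>(y1, y2). f y1 y2))"


section \<open>Block matrices and Mahalanobis costs\<close>

text \<open>
  \<open>(1 + q) \<times> (1 + q)\<close> matrices are indexed by \<^typ>\<open>unit + 'q\<close>: \<open>Inl ()\<close> is the coordinate of
  \<open>y \<in> \<real>\<close> and \<open>Inr j\<close> that of \<open>x\<^sub>j\<close>. The blocks \<open>V\<^sub>Y\<^sub>X\<close> (a row) and \<open>V\<^sub>X\<^sub>Y\<close> (a column) are both
  vectors, the \<open>1 \<times> 1\<close> block \<open>V\<^sub>Y\<^sub>Y\<close> is a real number.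
\<close>

definition stack :: "real \<times> (real ^ 'q) \<Rightarrow> real ^ (unit + 'q::finite)" where
  "stack s = (\<chi> i. case i of Inl _ \<Rightarrow> fst s | Inr j \<Rightarrow> snd s $ j)"

definition blk_YY :: "real ^ (unit + 'q) ^ (unit + 'q::finite) \<Rightarrow> real" where
  "blk_YY V = V $ Inl () $ Inl ()"

definition blk_YX :: "real ^ (unit + 'q) ^ (unit + 'q::finite) \<Rightarrow> real ^ 'q" where
  "blk_YX V = (\<chi> j. V $ Inl () $ Inr j)"

definition blk_XY :: "real ^ (unit + 'q) ^ (unit + 'q::finite) \<Rightarrow> real ^ 'q" where
  "blk_XY V = (\<chi> i. V $ Inr i $ Inl ())"

definition blk_XX :: "real ^ (unit + 'q) ^ (unit + 'q::finite) \<Rightarrow> real ^ 'q ^ 'q" where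
  "blk_XX V = (\<chi> i j. V $ Inr i $ Inr j)"

definition positive_definite :: "real ^ 'n ^ 'n::finite \<Rightarrow> bool" where
  "positive_definite A \<longleftrightarrow> transpose A = A \<and> (\<forall>v. v \<noteq> 0 \<longrightarrow> 0 < v \<bullet> (A *v v))"

definition schur_XX :: "real ^ (unit + 'q) ^ (unit + 'q::finite) \<Rightarrow> real" where
  "schur_XX V = blk_YY V - blk_YX V \<bullet> (matrix_inv (blk_XX V) *v blk_XY V)"

definition mahalanobis_cost ::
  "real ^ (unit + 'q) ^ (unit + 'q::finite) \<Rightarrow> real \<times> (real ^ 'q) \<Rightarrow> real \<times> (real ^ 'q) \<Rightarrow> real" where
  "mahalanobis_cost V s s' = (stack s - stack s') \<bullet> (matrix_inv V *v (stack s - stack s'))"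

definition mahalanobis_cost_Y ::
  "real ^ (unit + 'q) ^ (unit + 'q::finite) \<Rightarrow> real \<Rightarrow> real \<Rightarrow> real" where
  "mahalanobis_cost_Y V y y' = (y - y') * inverse (blk_YY V) * (y - y')"

end

theory Submission
  imports Defs
begin

text \<open>
  Blockwise inversion of \<open>V\<close> splits the cost of a displacement \<open>(\<eta>, \<xi>)\<close> into
  \<open>(\<eta> - B \<bullet> \<xi>)\<^sup>2 / S + \<xi> \<bullet> (A *v \<xi>)\<close> with \<open>A = V\<^sub>X\<^sub>X\<^sup>-\<^sup>1\<close>, \<open>B = A *v V\<^sub>X\<^sub>Y\<close> and
  \<open>S\<close> the Schur complement. Since the objective is linear and the costs are convex quadratic forms,
  Jensen's inequality shows that only the displacement of the means matters, and translating a
  gluing of the two reference measures attains every admissible displacement. The primal problem is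
  therefore a finite-dimensional concave maximisation over \<open>t\<^sub>\<ell> = \<eta>\<^sub>\<ell> - B\<^sub>\<ell> \<bullet> \<xi>\<close> and \<open>\<xi>\<close>. For
  positive radii a separating hyperplane gives the multipliers \<open>\<lambda>\<close>; if a radius vanishes, the dual
  is compared with slightly larger radii. The value is upper semicontinuous as an infimum of
  affine functions of \<open>\<delta>\<close>, and lower semicontinuous because it dominates \<open>\<theta>\<close> times itself when
  \<open>\<delta>\<close> is scaled by \<open>\<theta> \<le> 1\<close>.
\<close>

section \<open>Conditional laws and gluing\<close>

text \<open>What separates the two problems is that \<open>x\<close> is shared: one displacement
  \<open>\<xi>\<close> is charged in both constraints. In residual coordinates, with
  \<open>t1\<close> taken with reversed sign, the change of the objective is
  \<open>t1 + t2 + (B2 - B1) \<bullet> \<xi>\<close>, so \<open>Vo\<close> is the gain per unit of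
  \<open>\<xi>\<close>. If one radius is zero, \<open>\<xi> = 0\<close> is forced and a displacement
  \<open>\<eta>\<close> of \<open>y\<close> costs \<open>\<eta>\<^sup>2 / schur_XX V\<close>,
  against \<open>\<eta>\<^sup>2 / blk_YY V\<close> without covariates. The Schur complement is
  strictly smaller unless \<open>blk_XY V = 0\<close>, and the equality criterion rests on this
  comparison. Two obstacles shape the proof. A translation needs one joint law having both reference
  measures as marginals. It is built by redrawing \<open>y1\<close> from its conditional quantile
  function with an independent uniform variable, so that no kernels appear. The other obstacle is a
  vanishing radius: for \<open>d1 = 0\<close> the dual is strictly decreasing in \<open>l1\<close>,
  the infimum is not attained, and no multiplier can be read off a hyperplane.\<close>

text \<open>For fixed \<open>A\<close> the slices \<open>Z \<mapsto> M (Z \<times> A)\<close> are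
  finite measures on the line, determined by half-lines, and rectangles determine the measure.
  Strict half-lines suit the law of an infimum over rationals; \<open>UNIV\<close> enters separately
  because \<open>{..<t}\<close> never contains \<open>\<infinity>\<close>.\<close>

lemma measure_eqI_lessThan_Times:
  fixes M N :: "(ereal \<times> 'c::second_countable_topology) measure"
  assumes M: "sets M = sets borel" and N: "sets N = sets borel" and fin: "finite_measure M"
    and UNIV: "\<And>A. A \<in> sets borel \<Longrightarrow> emeasure M (UNIV \<times> A) = emeasure N (UNIV \<times> A)"
    and lessThan: "\<And>t A. A \<in> sets borel \<Longrightarrow> emeasure M ({..<t} \<times> A) = emeasure N ({..<t} \<times> A)"
  shows "M = N"
proof -
  have sM: "space M = UNIV" and sN: "space N = UNIV"
    using sets_eq_imp_space_eq[OF M] sets_eq_imp_space_eq[OF N] by auto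
  have rect: "emeasure M (X \<times> A) = emeasure N (X \<times> A)" if X: "X \<in> sets borel" and A: "A \<in> sets borel" for X A
  proof -
    let ?d = "\<lambda>K. distr (density K (indicator (UNIV \<times> A))) borel fst"
    have UA: "UNIV \<times> A \<in> sets borel"
      by (rule borel_Times[OF _ A]) simp
    have e: "emeasure (?d K) Z = emeasure K (Z \<times> A)"
      if "sets K = sets (borel :: (ereal \<times> 'c) measure)" "Z \<in> sets borel" for K Z
    proof -
      have ZA: "Z \<times> A \<in> sets K" and Z: "Z \<times> UNIV \<in> sets K"
        using that A by (auto intro!: borel_Times)
      have [measurable]: "fst \<in> measurable K borel"
        unfolding measurable_cong_sets[OF that(1) refl]
        by (intro borel_measurable_continuous_onI continuous_intros)
      have sp: "space K = UNIV" using sets_eq_imp_space_eq[OF that(1)] by simp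
      have v: "fst -` Z \<inter> space K = Z \<times> UNIV" unfolding sp by auto
      have "emeasure (?d K) Z = emeasure (density K (indicator (UNIV \<times> A))) (Z \<times> UNIV)"
        using that(2) v by (subst emeasure_distr) auto
      also have "\<dots> = (\<integral>\<^sup>+z. indicator (UNIV \<times> A) z * indicator (Z \<times> UNIV) z \<partial>K)"
        using UA Z that(1) by (subst emeasure_density) (auto intro!: borel_measurable_indicator)
      also have "\<dots> = (\<integral>\<^sup>+z. indicator (Z \<times> A) z \<partial>K)"
        by (intro nn_integral_cong) (auto simp: indicator_def)
      finally show ?thesis using ZA by simp
    qed
    have "?d M = ?d N"
    proof (rule measure_eqI_generator_eq[where \<Omega>=UNIV and E="insert UNIV (range lessThan)" and A="\<lambda>_. UNIV"])
      show "Int_stable (insert UNIV (range (lessThan :: ereal \<Rightarrow> _)))"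
      proof -
        have "{..<s} \<inter> {..<t} = {..<min s t}" for s t :: ereal by auto
        then show ?thesis by (intro Int_stableI) auto
      qed
      have "sets (borel :: ereal measure) = sigma_sets UNIV (range lessThan)"
        by (subst borel_Iio) auto
      also have "\<dots> = sigma_sets UNIV (insert UNIV (range lessThan))"
        by (intro sigma_sets_eqI) (auto intro: sigma_sets_top)
      finally show "sets (?d M) = sigma_sets UNIV (insert UNIV (range lessThan))"
        "sets (?d N) = sigma_sets UNIV (insert UNIV (range lessThan))" by auto
      show "emeasure (?d M) Z = emeasure (?d N) Z" if "Z \<in> insert UNIV (range lessThan)" for Z
        using that e[OF M, of Z] e[OF N, of Z] UNIV[OF A] lessThan[OF A] by auto
      show "emeasure (?d M) UNIV \<noteq> \<infinity>"
        using e[OF M, of UNIV] finite_measure.emeasure_finite[OF fin] by auto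
    qed auto
    then show ?thesis using e[OF M X] e[OF N X] by metis
  qed
  let ?E = "{a \<times> b |a b. a \<in> sets (borel :: ereal measure) \<and> b \<in> sets (borel :: 'c measure)}"
  have s: "sets (borel :: (ereal \<times> 'c) measure) = sigma_sets UNIV ?E"
    by (simp add: borel_prod[symmetric] sets_pair_measure)
  show ?thesis
  proof (rule measure_eqI_generator_eq[OF Int_stable_pair_measure_generator[of borel borel]])
    show "?E \<subseteq> Pow UNIV" by auto
    show "range (\<lambda>_. UNIV) \<subseteq> ?E" by (auto intro!: exI[of _ UNIV])
  qed (use M N s rect finite_measure.emeasure_finite[OF fin] in auto)
qed

text \<open>The sequence is the running maximum of an enumeration of \<open>R\<close>; a maximum
  over finitely many members stays in \<open>R\<close>.\<close>

lemma countable_chain_incseq: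
  fixes R :: "'a::linorder set"
  assumes "countable R" "R \<noteq> {}"
  obtains r :: "nat \<Rightarrow> 'a" where "incseq r" "range r \<subseteq> R" "\<And>x. x \<in> R \<Longrightarrow> \<exists>n. x \<le> r n"
proof
  define r where "r = (\<lambda>n. Max (from_nat_into R ` {..n}))"
  show "incseq r" unfolding r_def by (intro incseq_SucI Max_mono) auto
  show "range r \<subseteq> R"
  proof clarify
    fix n have "r n \<in> from_nat_into R ` {..n}" unfolding r_def by (intro Max_in) auto
    then show "r n \<in> R" using from_nat_into[OF assms(2)] by auto
  qed
  show "\<exists>n. x \<le> r n" if "x \<in> R" for x
  proof
    have "x = from_nat_into R (to_nat_on R x)" using that assms by simp
    then show "x \<le> r (to_nat_on R x)" unfolding r_def by (intro Max_ge) auto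
  qed
qed

lemma UN_cofinal:
  fixes R :: "'a::preorder set" and D :: "'a \<Rightarrow> 'd set"
  assumes q: "range q \<subseteq> R" "\<And>x. x \<in> R \<Longrightarrow> \<exists>n. x \<le> q n"
    and D: "\<And>r s. r \<in> R \<Longrightarrow> s \<in> R \<Longrightarrow> r \<le> s \<Longrightarrow> D r \<subseteq> D s"
  shows "(\<Union>r\<in>R. D r) = (\<Union>n. D (q n))"
proof
  show "(\<Union>r\<in>R. D r) \<subseteq> (\<Union>n. D (q n))"
  proof clarify
    fix y r assume "r \<in> R" "y \<in> D r"
    moreover obtain n where "r \<le> q n" using q(2)[OF \<open>r \<in> R\<close>] by auto
    ultimately show "y \<in> (\<Union>n. D (q n))" using D[of r "q n"] q(1) by blast
  qed
qed (use q(1) in auto)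

text \<open>Continuity from below works along sequences, while the chains met below are indexed by
  rationals. A single cofinal sequence serves both families.\<close>

lemma emeasure_UN_chain_eq:
  fixes R :: "'a::linorder set"
  assumes "countable R"
    and "\<And>r. r \<in> R \<Longrightarrow> E r \<in> sets M" "\<And>r. r \<in> R \<Longrightarrow> F r \<in> sets N"
    and "\<And>r s. r \<in> R \<Longrightarrow> s \<in> R \<Longrightarrow> r \<le> s \<Longrightarrow> E r \<subseteq> E s"
    and "\<And>r s. r \<in> R \<Longrightarrow> s \<in> R \<Longrightarrow> r \<le> s \<Longrightarrow> F r \<subseteq> F s"
    and "\<And>r. r \<in> R \<Longrightarrow> emeasure M (E r) = emeasure N (F r)"
  shows "emeasure M (\<Union>r\<in>R. E r) = emeasure N (\<Union>r\<in>R. F r)"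
proof (cases "R = {}")
  case False
  obtain q where q: "incseq q" "range q \<subseteq> R" "\<And>x. x \<in> R \<Longrightarrow> \<exists>n. x \<le> q n"
    using countable_chain_incseq[OF assms(1) False] by blast
  have qR: "q n \<in> R" for n using q(2) by auto
  have E: "(\<Union>r\<in>R. E r) = (\<Union>n. E (q n))" and F: "(\<Union>r\<in>R. F r) = (\<Union>n. F (q n))"
    by (intro UN_cofinal q assms; assumption)+
  have mono: "E (q m) \<subseteq> E (q n)" "F (q m) \<subseteq> F (q n)" if "m \<le> n" for m n
    using assms(4,5) qR incseqD[OF q(1) that] by blast+
  have "emeasure M (\<Union>n. E (q n)) = (SUP n. emeasure M (E (q n)))"
    using qR assms(2) mono by (intro SUP_emeasure_incseq[symmetric]) (auto simp: incseq_def le_fun_def)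
  also have "\<dots> = (SUP n. emeasure N (F (q n)))" using assms(6) qR by simp
  also have "\<dots> = emeasure N (\<Union>n. F (q n))"
    using qR assms(3) mono by (intro SUP_emeasure_incseq) (auto simp: incseq_def le_fun_def)
  finally show ?thesis unfolding E F .
qed simp

text \<open>The inequality of measures is tested on the set where \<open>g < f\<close>. The integral
  of a difference splits in \<open>ennreal\<close> only for a finite subtrahend, hence the condition
  on the mass of \<open>density M g\<close>.\<close>

lemma (in finite_measure) AE_le_of_density_le:
  assumes [measurable]: "f \<in> borel_measurable M" "g \<in> borel_measurable M"
    and le: "\<And>A. A \<in> sets M \<Longrightarrow> emeasure (density M f) A \<le> emeasure (density M g) A"
    and fin: "emeasure (density M g) (space M) \<noteq> \<infinity>"
  shows "AE x in M. f x \<le> g x"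
proof -
  let ?P = "{x \<in> space M. g x < f x}"
  have P: "?P \<in> sets M" by measurable
  have gfin: "(\<integral>\<^sup>+x. g x * indicator ?P x \<partial>M) \<noteq> \<infinity>"
  proof -
    have "(\<integral>\<^sup>+x. g x * indicator ?P x \<partial>M) = emeasure (density M g) ?P"
      using P by (simp add: emeasure_density)
    also have "\<dots> \<le> emeasure (density M g) (space M)"
      by (rule emeasure_mono) auto
    finally show ?thesis using fin by (auto simp: top_unique)
  qed
  let ?F = "\<integral>\<^sup>+x. f x * indicator ?P x \<partial>M" and ?G = "\<integral>\<^sup>+x. g x * indicator ?P x \<partial>M"
  have FG: "?F \<le> ?G" using le[OF P] P by (simp add: emeasure_density)
  have "(\<integral>\<^sup>+x. f x * indicator ?P x - g x * indicator ?P x \<partial>M) = ?F - ?G"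
    by (rule nn_integral_diff) (use gfin in \<open>auto simp: indicator_def\<close>)
  also have "\<dots> = 0" using FG gfin by (intro diff_eq_0_ennreal) (auto simp: less_top)
  finally have "AE x in M. f x * indicator ?P x - g x * indicator ?P x = 0"
    by (subst (asm) nn_integral_0_iff_AE) auto
  then show ?thesis
  proof (rule AE_mp, intro AE_I2 impI)
    fix x assume x: "x \<in> space M" and eq: "f x * indicator ?P x - g x * indicator ?P x = 0"
    show "f x \<le> g x"
    proof (rule ccontr)
      assume "\<not> f x \<le> g x"
      then have "g x < f x" by simp
      then have "0 < f x - g x" by (simp add: diff_gt_0_iff_gt_ennreal)
      with eq x \<open>g x < f x\<close> show False by simp
    qed
  qed
qed

section \<open>Conditional quantiles driven by a uniform variable\<close>

definition uniform_01 :: "real measure" where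
  "uniform_01 = uniform_measure lborel {0..1}"

lemma prob_space_uniform_01: "prob_space uniform_01"
  unfolding uniform_01_def by (rule prob_space_uniform_measure) auto

lemma sets_uniform_01 [simp, measurable_cong]: "sets uniform_01 = sets borel"
  by (simp add: uniform_01_def)

lemma space_uniform_01 [simp]: "space uniform_01 = UNIV"
  by (simp add: uniform_01_def)

lemma emeasure_uniform_01_atMost:
  assumes "p \<le> 1"
  shows "emeasure uniform_01 {u. ennreal u \<le> p} = p"
proof -
  obtain r where p: "p = ennreal r" and r: "0 \<le> r" "r \<le> 1"
    using assms by (cases p) (auto simp: top_unique)
  \<comment> \<open>Since \<open>ennreal u = 0\<close> for negative \<open>u\<close>, the set
    contains the negative half-line; intersecting with the support discards it.\<close>
  have "{0..1} \<inter> {u. ennreal u \<le> p} = {0..r}"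
    using r by (auto simp: p ennreal_le_iff)
  moreover have "{u. ennreal u \<le> p} \<in> sets lborel" by measurable
  ultimately show ?thesis using r by (simp add: uniform_01_def p divide_ennreal_def)
qed

text \<open>The functions \<open>g r\<close> are versions of the conditional distribution function
  of the first component given the second. Radon-Nikodym densities are ordered only almost
  everywhere, but the sets \<open>u \<le> g r x\<close> have to grow with \<open>r\<close> at every
  \<open>x\<close>, so order and bound are enforced pointwise.\<close>

lemma conditional_cdf:
  fixes \<mu> :: "(real \<times> 'c::second_countable_topology) measure"
  assumes \<mu>: "\<mu> \<in> borel_probs"
  obtains g :: "real \<Rightarrow> 'c \<Rightarrow> ennreal" where
    "\<And>r. r \<in> \<rat> \<Longrightarrow> g r \<in> borel_measurable borel"
    "\<And>r s x. r \<in> \<rat> \<Longrightarrow> s \<in> \<rat> \<Longrightarrow> r \<le> s \<Longrightarrow> g r x \<le> g s x"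
    "\<And>r x. g r x \<le> 1"
    "\<And>r A. r \<in> \<rat> \<Longrightarrow> A \<in> sets borel \<Longrightarrow>
      emeasure \<mu> ({..r} \<times> A) = (\<integral>\<^sup>+x. g r x * indicator A x \<partial>distr \<mu> borel snd)"
proof -
  interpret \<mu>: prob_space \<mu> using \<mu> by (simp add: borel_probs_def)
  have s\<mu> [simp, measurable_cong]: "sets \<mu> = sets borel" using \<mu> by (simp add: borel_probs_def)
  have sp [simp]: "space \<mu> = UNIV" using sets_eq_imp_space_eq[OF s\<mu>] by simp
  have snd [measurable]: "snd \<in> measurable \<mu> borel"
    unfolding measurable_cong_sets[OF s\<mu> refl] by (intro borel_measurable_continuous_onI continuous_intros)
  let ?\<nu> = "distr \<mu> borel snd"
  interpret \<nu>: prob_space ?\<nu> by (rule \<mu>.prob_space_distr) simp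
  have rect: "X \<times> A \<in> sets \<mu>" if "X \<in> sets borel" "A \<in> sets borel" for X :: "real set" and A :: "'c set"
    using that by (auto intro!: borel_Times)
  define N where "N r = distr (density \<mu> (indicator ({..r} \<times> UNIV))) borel snd" for r
  have N: "emeasure (N r) A = emeasure \<mu> ({..r} \<times> A)" if "A \<in> sets borel" for r A
  proof -
    have v: "snd -` A \<inter> space \<mu> = UNIV \<times> A" by auto
    have "emeasure (N r) A = emeasure (density \<mu> (indicator ({..r} \<times> UNIV))) (UNIV \<times> A)"
      using that v unfolding N_def by (subst emeasure_distr) (auto intro: measurable_cong_sets[THEN equalityD1, THEN subsetD])
    also have "\<dots> = (\<integral>\<^sup>+z. indicator ({..r} \<times> UNIV) z * indicator (UNIV \<times> A) z \<partial>\<mu>)"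
    proof (rule emeasure_density)
      show "indicator ({..r} \<times> UNIV) \<in> borel_measurable \<mu>"
        by (intro borel_measurable_indicator rect) auto
      show "UNIV \<times> A \<in> sets \<mu>" using that by (intro rect) auto
    qed
    also have "\<dots> = (\<integral>\<^sup>+z. indicator ({..r} \<times> A) z \<partial>\<mu>)"
      by (intro nn_integral_cong) (auto simp: indicator_def)
    finally show ?thesis using rect[of "{..r}" A] that by simp
  qed
  have \<nu>A: "emeasure ?\<nu> A = emeasure \<mu> (UNIV \<times> A)" if "A \<in> sets borel" for A
  proof -
    have v: "snd -` A \<inter> space \<mu> = UNIV \<times> A" by auto
    show ?thesis using that v by (subst emeasure_distr) auto
  qed
  have "\<exists>f \<in> borel_measurable ?\<nu>. density ?\<nu> f = N r" for r
  proof (rule \<nu>.Radon_Nikodym_finite_measure)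
    show "finite_measure (N r)"
      by (rule finite_measureI) (use N[of UNIV r] in \<open>simp add: N_def\<close>)
    show "sets (N r) = sets ?\<nu>" by (simp add: N_def)
    show "absolutely_continuous ?\<nu> (N r)"
    proof (unfold absolutely_continuous_def, rule)
      fix A assume "A \<in> null_sets ?\<nu>"
      then have A: "A \<in> sets borel" and "emeasure \<mu> (UNIV \<times> A) = 0"
        by (auto simp: \<nu>A null_sets_def)
      moreover have "emeasure \<mu> ({..r} \<times> A) \<le> emeasure \<mu> (UNIV \<times> A)"
        using A by (intro emeasure_mono rect) auto
      ultimately show "A \<in> null_sets (N r)" by (auto simp: null_sets_def N) (simp add: N_def)
    qed
  qed
  then obtain f where f: "\<And>r. f r \<in> borel_measurable ?\<nu>" and dens: "\<And>r. density ?\<nu> (f r) = N r"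
    by metis
  have f' [measurable]: "f r \<in> borel_measurable borel" for r using f[of r] by simp
  have mono: "AE x in ?\<nu>. f r x \<le> f s x" if "r \<le> s" for r s
  proof (rule \<nu>.AE_le_of_density_le)
    show "emeasure (density ?\<nu> (f r)) A \<le> emeasure (density ?\<nu> (f s)) A" if "A \<in> sets ?\<nu>" for A
      using that \<open>r \<le> s\<close> by (auto simp: dens N intro!: emeasure_mono borel_Times)
    show "emeasure (density ?\<nu> (f s)) (space ?\<nu>) \<noteq> \<infinity>" by (simp add: dens N)
  qed (simp_all add: f')
  have le1: "AE x in ?\<nu>. f r x \<le> 1" for r
  proof (rule \<nu>.AE_le_of_density_le)
    show "emeasure (density ?\<nu> (f r)) A \<le> emeasure (density ?\<nu> (\<lambda>_. 1)) A" if "A \<in> sets ?\<nu>" for A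
      using that by (auto simp: dens N density_1 \<nu>A intro!: emeasure_mono borel_Times)
    show "emeasure (density ?\<nu> (\<lambda>_. 1)) (space ?\<nu>) \<noteq> \<infinity>" by (simp add: density_1)
  qed (simp_all add: f')
  \<comment> \<open>A supremum over smaller rationals is monotone by construction, and the minimum
    caps it. For rational \<open>r\<close> the family contains \<open>f r\<close> itself and
    countably many terms that lie below it almost everywhere, so \<open>g r\<close> is still a
    version of \<open>f r\<close>.\<close>
  define g where "g r x = min 1 (SUP s\<in>{s\<in>\<rat>. s \<le> r}. f s x)" for r x
  have cQ: "countable {s\<in>\<rat>. s \<le> r}" for r :: real
    by (rule countable_subset[OF _ countable_rat]) auto
  have "AE x in ?\<nu>. g r x = f r x" if "r \<in> \<rat>" for r
  proof -
    have "AE x in ?\<nu>. \<forall>s\<in>{s\<in>\<rat>. s \<le> r}. f s x \<le> f r x"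
      by (subst AE_ball_countable[OF cQ]) (auto intro: mono)
    with le1[of r] show ?thesis
    proof eventually_elim
      case (elim x)
      have "(SUP s\<in>{s\<in>\<rat>. s \<le> r}. f s x) = f r x"
        using elim that by (intro antisym SUP_least SUP_upper) auto
      then show ?case using elim by (simp add: g_def min_def)
    qed
  qed
  then have ae: "(\<integral>\<^sup>+x. g r x * indicator A x \<partial>?\<nu>) = (\<integral>\<^sup>+x. f r x * indicator A x \<partial>?\<nu>)"
    if "r \<in> \<rat>" for r A
    using \<open>\<And>r. r \<in> \<rat> \<Longrightarrow> AE x in ?\<nu>. g r x = f r x\<close>[OF that]
    by (intro nn_integral_cong_AE) (auto elim!: eventually_mono)
  show thesis
  proof (rule that[of g])
    show "g r \<in> borel_measurable borel" for r
      unfolding g_def using cQ by measurable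
    show "g r x \<le> g s x" if "r \<le> s" for r s x
      unfolding g_def using that by (intro min.mono SUP_subset_mono) auto
    show "g r x \<le> 1" for r x by (simp add: g_def)
    show "emeasure \<mu> ({..r} \<times> A) = (\<integral>\<^sup>+x. g r x * indicator A x \<partial>?\<nu>)"
      if "r \<in> \<rat>" "A \<in> sets borel" for r A
      using that N[OF that(2), of r] by (simp add: ae dens[symmetric] emeasure_density)
  qed
qed

text \<open>
  \<open>Q\<close> is the conditional quantile function of the first component, built from the Radon-Nikodym
  densities of \<open>A \<mapsto> \<mu> ({..r} \<times> A)\<close> at rational \<open>r\<close>. It may be infinite on a null set, so the law is
  first identified on \<^typ>\<open>ereal\<close>.
\<close>

lemma noise_outsourcing:
  fixes \<mu> :: "(real \<times> 'c::second_countable_topology) measure"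
  assumes \<mu>: "\<mu> \<in> borel_probs"
  obtains Q :: "'c \<times> real \<Rightarrow> real" where "Q \<in> borel_measurable borel"
    "distr (distr \<mu> borel snd \<Otimes>\<^sub>M uniform_01) borel (\<lambda>(x, u). (Q (x, u), x)) = \<mu>"
proof -
  interpret \<mu>: prob_space \<mu> using \<mu> by (simp add: borel_probs_def)
  have s\<mu> [simp, measurable_cong]: "sets \<mu> = sets borel" using \<mu> by (simp add: borel_probs_def)
  have sp [simp]: "space \<mu> = UNIV" using sets_eq_imp_space_eq[OF s\<mu>] by simp
  have snd [measurable]: "snd \<in> measurable \<mu> borel"
    unfolding measurable_cong_sets[OF s\<mu> refl] by (intro borel_measurable_continuous_onI continuous_intros)
  have fst [measurable]: "fst \<in> measurable \<mu> borel"
    unfolding measurable_cong_sets[OF s\<mu> refl] by (intro borel_measurable_continuous_onI continuous_intros)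
  let ?\<nu> = "distr \<mu> borel snd"
  interpret \<nu>: prob_space ?\<nu> by (rule \<mu>.prob_space_distr) simp
  interpret U: prob_space uniform_01 by (rule prob_space_uniform_01)
  interpret P: pair_prob_space ?\<nu> uniform_01 ..
  let ?P = "?\<nu> \<Otimes>\<^sub>M uniform_01"
  have sP [measurable_cong]: "sets ?P = sets (borel \<Otimes>\<^sub>M borel)"
    by (intro sets_pair_measure_cong) auto
  have spP [simp]: "space ?P = UNIV" by (simp add: space_pair_measure)
  obtain g :: "real \<Rightarrow> 'c \<Rightarrow> ennreal" where
    gm [measurable]: "\<And>r. r \<in> \<rat> \<Longrightarrow> g r \<in> borel_measurable borel" and
    mono: "\<And>r s x. r \<in> \<rat> \<Longrightarrow> s \<in> \<rat> \<Longrightarrow> r \<le> s \<Longrightarrow> g r x \<le> g s x" and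
    le1: "\<And>r x. g r x \<le> 1" and
    cdf: "\<And>r A. r \<in> \<rat> \<Longrightarrow> A \<in> sets borel \<Longrightarrow>
      emeasure \<mu> ({..r} \<times> A) = (\<integral>\<^sup>+x. g r x * indicator A x \<partial>?\<nu>)"
    using conditional_cdf[OF \<mu>] by blast
  define G where "G z = (INF r\<in>{r\<in>\<rat>. ennreal (snd z) \<le> g r (fst z)}. ereal r)" for z
  \<comment> \<open>An infimum lies strictly below \<open>t\<close> exactly when some member does.
    The event is thus a countable union of events \<open>u \<le> g r x\<close>, which yields both
    the measurability and the law of \<open>G\<close>.\<close>
  have Gless: "G z < t \<longleftrightarrow> (\<exists>r\<in>{r\<in>\<rat>. ereal r < t}. ennreal (snd z) \<le> g r (fst z))" for z t
    unfolding G_def by (auto simp: INF_less_iff)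
  have cQ: "countable {r\<in>\<rat>. ereal r < t}" for t
    by (rule countable_subset[OF _ countable_rat]) auto
  have E: "{z. fst z \<in> A \<and> ennreal (snd z) \<le> g r (fst z)} \<in> sets ?P"
    if [measurable]: "r \<in> \<rat>" "A \<in> sets borel" for r A
  proof -
    have "{z \<in> space ?P. fst z \<in> A \<and> ennreal (snd z) \<le> g r (fst z)} \<in> sets ?P"
      by measurable
    then show ?thesis by simp
  qed
  have Gm: "G \<in> borel_measurable ?P"
  proof (subst borel_measurable_ereal_iff_Iio, intro allI)
    fix t
    have "G -` {..<t} \<inter> space ?P = (\<Union>r\<in>{r\<in>\<rat>. ereal r < t}. {z. fst z \<in> UNIV \<and> ennreal (snd z) \<le> g r (fst z)})"
      by (auto simp: Gless)
    also have "\<dots> \<in> sets ?P" 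
    proof (rule sets.countable_UN''[OF cQ])
      show "{z. fst z \<in> UNIV \<and> ennreal (snd z) \<le> g r (fst z)} \<in> sets ?P" if "r \<in> {r\<in>\<rat>. ereal r < t}" for r
        using that by (intro E) auto
    qed
    finally show "G -` {..<t} \<inter> space ?P \<in> sets ?P" .
  qed
  note Gm [measurable]
  let ?M = "distr ?P borel (\<lambda>z. (G z, fst z))" and ?N = "distr \<mu> borel (\<lambda>s. (ereal (fst s), snd s))"
  have mM [measurable]: "(\<lambda>z. (G z, fst z)) \<in> measurable ?P borel"
    unfolding case_prod_beta by (intro borel_measurable_Pair) measurable
  have mN [measurable]: "(\<lambda>s. (ereal (fst s), snd s)) \<in> measurable \<mu> borel"
    unfolding case_prod_beta by (intro borel_measurable_Pair) measurable
  have "?M = ?N"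
  proof (rule measure_eqI_lessThan_Times)
    show "finite_measure ?M"
      by (intro prob_space.finite_measure P.prob_space_distr mM)
    fix A :: "'c set" assume A: "A \<in> sets borel"
    have "emeasure ?M (UNIV \<times> A) = emeasure ?P (A \<times> UNIV)"
      using A by (subst emeasure_distr) (auto intro!: borel_Times arg_cong2[where f=emeasure])
    also have "\<dots> = emeasure ?\<nu> A"
      using A U.emeasure_space_1 by (subst U.emeasure_pair_measure_Times) auto
    also have "\<dots> = emeasure \<mu> (UNIV \<times> A)"
      using A by (subst emeasure_distr) (auto intro!: arg_cong2[where f=emeasure])
    also have "\<dots> = emeasure ?N (UNIV \<times> A)"
      using A by (subst emeasure_distr) (auto intro!: borel_Times arg_cong2[where f=emeasure])
    finally show "emeasure ?M (UNIV \<times> A) = emeasure ?N (UNIV \<times> A)" .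
    fix t :: ereal
    have "emeasure ?M ({..<t} \<times> A) =
        emeasure ?P (\<Union>r\<in>{r\<in>\<rat>. ereal r < t}. {z. fst z \<in> A \<and> ennreal (snd z) \<le> g r (fst z)})"
      using A by (subst emeasure_distr) (auto simp: Gless intro!: borel_Times arg_cong2[where f=emeasure])
    also have "\<dots> = emeasure \<mu> (\<Union>r\<in>{r\<in>\<rat>. ereal r < t}. {..r} \<times> A)"
    proof (rule emeasure_UN_chain_eq[OF cQ])
      fix r assume r: "r \<in> {r\<in>\<rat>. ereal r < t}"
      then have [measurable]: "r \<in> \<rat>" by auto
      show "{z. fst z \<in> A \<and> ennreal (snd z) \<le> g r (fst z)} \<in> sets ?P" using E A r by auto
      show "{..r} \<times> A \<in> sets \<mu>" using A by (auto intro!: borel_Times)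
      have "emeasure ?P {z. fst z \<in> A \<and> ennreal (snd z) \<le> g r (fst z)} =
          (\<integral>\<^sup>+x. emeasure uniform_01 (Pair x -` {z. fst z \<in> A \<and> ennreal (snd z) \<le> g r (fst z)}) \<partial>?\<nu>)"
        using E[of r A] A r by (intro U.emeasure_pair_measure_alt) auto
      also have "\<dots> = (\<integral>\<^sup>+x. g r x * indicator A x \<partial>?\<nu>)"
      proof (intro nn_integral_cong)
        fix x
        show "emeasure uniform_01 (Pair x -` {z. fst z \<in> A \<and> ennreal (snd z) \<le> g r (fst z)}) = g r x * indicator A x"
          using emeasure_uniform_01_atMost[OF le1, of r x] by (cases "x \<in> A") (auto simp: vimage_def)
      qed
      also have "\<dots> = emeasure \<mu> ({..r} \<times> A)" using cdf[of r A] r A by auto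
      finally show "emeasure ?P {z. fst z \<in> A \<and> ennreal (snd z) \<le> g r (fst z)} = emeasure \<mu> ({..r} \<times> A)" .
    qed (use mono in \<open>auto intro: order_trans\<close>)
    also have "(\<Union>r\<in>{r\<in>\<rat>. ereal r < t}. {..r} \<times> A) = {s. ereal (fst s) < t \<and> snd s \<in> A}"
    proof (intro set_eqI iffI)
      fix s assume "s \<in> {s. ereal (fst s) < t \<and> snd s \<in> A}"
      then have s: "ereal (fst s) < t" "snd s \<in> A" by auto
      obtain r where r: "ereal (fst s) < ereal r" "ereal r < t" using ereal_dense2[OF s(1)] by auto
      then obtain q where "q \<in> \<rat>" "fst s < q" "q < r" using Rats_dense_in_real[of "fst s" r] by auto
      with r s show "s \<in> (\<Union>r\<in>{r\<in>\<rat>. ereal r < t}. {..r} \<times> A)"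
        by (intro UN_I[of q]) (auto intro: less_trans[of "ereal q" "ereal r"] simp: mem_Times_iff)
    qed (auto intro: le_less_trans[of "ereal _" "ereal _"])
    also have "emeasure \<mu> \<dots> = emeasure ?N ({..<t} \<times> A)"
      using A by (subst emeasure_distr) (auto intro!: borel_Times arg_cong2[where f=emeasure])
    finally show "emeasure ?M ({..<t} \<times> A) = emeasure ?N ({..<t} \<times> A)" .
  qed simp_all
  \<comment> \<open>On the right \<open>real_of_ereal\<close> undoes the embedding of the reals, so
    pushing both sides forward removes infinite values of \<open>G\<close> without a separate
    null-set argument.\<close>
  then have eq: "distr ?M borel (\<lambda>s. (real_of_ereal (fst s), snd s)) = distr ?N borel (\<lambda>s. (real_of_ereal (fst s), snd s))"
    by simp
  have m1 [measurable]: "(\<lambda>s. (real_of_ereal (fst s), snd s)) \<in> measurable (borel :: (ereal \<times> 'c) measure) borel"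
    by (subst (1 2) borel_prod[symmetric]) measurable
  show thesis
  proof (rule that[of "\<lambda>z. real_of_ereal (G z)"])
    show "(\<lambda>z. real_of_ereal (G z)) \<in> borel_measurable borel"
      using Gm unfolding measurable_cong_sets[OF sP refl] borel_prod by measurable
    have "distr ?P borel (\<lambda>(x, u). (real_of_ereal (G (x, u)), x)) = distr ?M borel (\<lambda>s. (real_of_ereal (fst s), snd s))"
      by (subst distr_distr[OF m1 mM]) (rule distr_cong, auto)
    also have "\<dots> = distr ?N borel (\<lambda>s. (real_of_ereal (fst s), snd s))" by (rule eq)
    also have "\<dots> = distr \<mu> \<mu> (\<lambda>s. s)"
      by (subst distr_distr[OF m1 mN])
        (rule distr_cong, auto)
    also have "\<dots> = \<mu>" by (rule distr_id)
    finally show "distr ?P borel (\<lambda>(x, u). (real_of_ereal (G (x, u)), x)) = \<mu>" .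
  qed
qed

text \<open>Keep \<open>(y2, x)\<close> with law \<open>\<nu>\<close> and set
  \<open>y1 = Q (x, u)\<close> for an independent uniform \<open>u\<close>. As \<open>x\<close> has
  the same law under both measures, \<open>(y1, x)\<close> has law \<open>\<mu>\<close>. The result
  makes \<open>y1\<close> and \<open>y2\<close> conditionally independent given \<open>x\<close>,
  but only its marginals are used.\<close>

lemma gluing:
  fixes \<mu> :: "(real \<times> 'c::second_countable_topology) measure"
    and \<nu> :: "('b::second_countable_topology \<times> 'c) measure"
  assumes \<mu>: "\<mu> \<in> borel_probs" and \<nu>: "\<nu> \<in> borel_probs"
    and eq: "distr \<mu> borel snd = distr \<nu> borel snd"
  obtains \<gamma> :: "(real \<times> 'b \<times> 'c) measure" where "\<gamma> \<in> borel_probs"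
    "distr \<gamma> borel (\<lambda>(y1, y2, x). (y1, x)) = \<mu>" "distr \<gamma> borel (\<lambda>(y1, y2, x). (y2, x)) = \<nu>"
proof -
  obtain Q :: "'c \<times> real \<Rightarrow> real" where Q [measurable]: "Q \<in> borel_measurable borel" and
    law: "distr (distr \<mu> borel snd \<Otimes>\<^sub>M uniform_01) borel (\<lambda>(x, u). (Q (x, u), x)) = \<mu>"
    using noise_outsourcing[OF \<mu>] by blast
  interpret \<nu>: prob_space \<nu> using \<nu> by (simp add: borel_probs_def)
  interpret U: prob_space uniform_01 by (rule prob_space_uniform_01)
  interpret P: pair_prob_space \<nu> uniform_01 ..
  let ?P = "\<nu> \<Otimes>\<^sub>M uniform_01"
  have s\<nu> [simp, measurable_cong]: "sets \<nu> = sets (borel \<Otimes>\<^sub>M borel)"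
    using \<nu> by (simp only: borel_prod) (simp add: borel_probs_def)
  have sP [measurable_cong]: "sets ?P = sets ((borel \<Otimes>\<^sub>M borel) \<Otimes>\<^sub>M borel)"
    by (intro sets_pair_measure_cong) auto
  have Q' [measurable]: "Q \<in> borel_measurable (borel \<Otimes>\<^sub>M borel)" using Q by (simp add: borel_prod)
  have m [measurable]: "(\<lambda>z. (Q (snd (fst z), snd z), fst (fst z), snd (fst z))) \<in> measurable ?P borel"
    by (intro borel_measurable_Pair) measurable
  have p1 [measurable]: "(\<lambda>(y1, y2, x). (y1, x)) \<in> measurable (borel :: (real \<times> 'b \<times> 'c) measure) borel"
    unfolding case_prod_beta by (intro borel_measurable_continuous_onI continuous_intros)
  have p2 [measurable]: "(\<lambda>(y1, y2, x). (y2, x)) \<in> measurable (borel :: (real \<times> 'b \<times> 'c) measure) borel"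
    unfolding case_prod_beta by (intro borel_measurable_continuous_onI continuous_intros)
  have q [measurable]: "(\<lambda>(x, u). (Q (x, u), x)) \<in> measurable (distr \<nu> borel snd \<Otimes>\<^sub>M uniform_01) borel"
    unfolding case_prod_beta by (intro borel_measurable_Pair) measurable
  let ?\<gamma> = "distr ?P borel (\<lambda>z. (Q (snd (fst z), snd z), fst (fst z), snd (fst z)))"
  show thesis
  proof (rule that[of ?\<gamma>])
    show "?\<gamma> \<in> borel_probs"
      using P.prob_space_distr[OF m] by (simp only: borel_probs_def mem_Collect_eq sets_distr simp_thms)
    have e: "distr \<nu> borel snd \<Otimes>\<^sub>M uniform_01 = distr ?P (borel \<Otimes>\<^sub>M borel) (\<lambda>(s, u). (snd s, u))"
    proof -
      have "distr uniform_01 borel (\<lambda>u. u) = uniform_01" by (rule distr_id2) simp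
      moreover have "distr \<nu> borel snd \<Otimes>\<^sub>M distr uniform_01 borel (\<lambda>u. u) = distr ?P (borel \<Otimes>\<^sub>M borel) (\<lambda>(s, u). (snd s, u))"
      proof (rule pair_measure_distr)
        show "sigma_finite_measure (distr uniform_01 borel (\<lambda>u. u))"
          unfolding \<open>distr uniform_01 borel (\<lambda>u. u) = uniform_01\<close> by (rule U.sigma_finite_measure_axioms)
      qed measurable
      ultimately show ?thesis by simp
    qed
    have q': "(\<lambda>(x, u). (Q (x, u), x)) \<in> measurable (borel \<Otimes>\<^sub>M borel) borel"
      unfolding case_prod_beta by (intro borel_measurable_Pair) measurable
    have n: "(\<lambda>(s, u). (snd s, u)) \<in> measurable ?P (borel \<Otimes>\<^sub>M borel)"
      by measurable
    have "distr ?\<gamma> borel (\<lambda>(y1, y2, x). (y1, x)) = distr ?P borel (\<lambda>z. (Q (snd (fst z), snd z), snd (fst z)))"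
      by (subst distr_distr[OF p1 m]) (simp only: comp_def case_prod_conv)
    also have "\<dots> = distr (distr ?P (borel \<Otimes>\<^sub>M borel) (\<lambda>(s, u). (snd s, u))) borel (\<lambda>(x, u). (Q (x, u), x))"
      by (subst distr_distr[OF q' n]) (simp only: comp_def case_prod_beta fst_conv snd_conv)
    also have "\<dots> = \<mu>" using law unfolding eq e .
    finally show "distr ?\<gamma> borel (\<lambda>(y1, y2, x). (y1, x)) = \<mu>" .
    have "distr ?\<gamma> borel (\<lambda>(y1, y2, x). (y2, x)) = distr ?P borel fst"
      by (subst distr_distr[OF p2 m]) (rule distr_cong, auto)
    also have "\<dots> = distr ?P \<nu> fst" by (rule distr_cong) (simp_all add: borel_prod[symmetric])
    also have "\<dots> = \<nu>" by (rule U.distr_pair_fst)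
    finally show "distr ?\<gamma> borel (\<lambda>(y1, y2, x). (y2, x)) = \<nu>" .
  qed
qed

section \<open>Positive definite block matrices\<close>

lemma symmetric_matrix_inner:
  fixes A :: "real ^ 'n ^ 'n::finite"
  assumes "transpose A = A"
  shows "u \<bullet> (A *v v) = (A *v u) \<bullet> v"
  using dot_lmul_matrix[of u A v] transpose_matrix_vector[of A u] assms by simp

lemma positive_definite_imp_symmetric: "positive_definite A \<Longrightarrow> transpose A = A"
  by (simp add: positive_definite_def)

lemma positive_definite_pos: "positive_definite A \<Longrightarrow> v \<noteq> 0 \<Longrightarrow> 0 < v \<bullet> (A *v v)"
  by (simp add: positive_definite_def)

lemma positive_definite_nonneg: "positive_definite A \<Longrightarrow> 0 \<le> v \<bullet> (A *v v)"
  using positive_definite_pos[of A v] by (cases "v = 0") auto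

lemma positive_definite_invertible:
  assumes "positive_definite A"
  shows "invertible A"
proof -
  have "v = 0" if "A *v v = 0" for v
    using positive_definite_pos[OF assms, of v] that by (cases "v = 0") auto
  then show ?thesis
    by (metis matrix_left_invertible_ker invertible_left_inverse)
qed

lemma matrix_inv_inverse:
  assumes "invertible A"
  shows matrix_inv_right: "A ** matrix_inv A = mat 1" and matrix_inv_left: "matrix_inv A ** A = mat 1"
  using assms someI_ex[of "\<lambda>A'. A ** A' = mat 1 \<and> A' ** A = mat 1"]
  by (auto simp: matrix_inv_def invertible_def)

lemma matrix_inv_eqI:
  fixes A :: "real ^ 'n ^ 'n::finite"
  assumes "invertible A" "A *v u = v"
  shows "matrix_inv A *v v = u"
  using assms matrix_inv_left[OF assms(1)] by (metis matrix_vector_mul_assoc matrix_vector_mul_lid)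

lemma matrix_inv_right_apply:
  fixes A :: "real ^ 'n ^ 'n::finite"
  assumes "invertible A"
  shows "A *v (matrix_inv A *v v) = v"
  using matrix_inv_right[OF assms] by (metis matrix_vector_mul_assoc matrix_vector_mul_lid)

lemma positive_definite_matrix_inv:
  assumes "positive_definite A"
  shows "positive_definite (matrix_inv A)"
proof -
  note inv = positive_definite_invertible[OF assms]
  have "transpose (matrix_inv A) ** A = mat 1"
    using arg_cong[OF matrix_inv_right[OF inv], of transpose] positive_definite_imp_symmetric[OF assms]
    by (simp add: matrix_transpose_mul transpose_mat)
  then have "transpose (matrix_inv A) = matrix_inv A"
    by (metis inv matrix_inv_right matrix_mul_assoc matrix_mul_lid matrix_mul_rid)
  moreover have "0 < v \<bullet> (matrix_inv A *v v)" if "v \<noteq> 0" for v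
  proof -
    define u where "u = matrix_inv A *v v"
    have u: "A *v u = v" unfolding u_def by (rule matrix_inv_right_apply[OF inv])
    with that have "u \<noteq> 0" by auto
    with positive_definite_pos[OF assms] u show ?thesis
      by (metis u_def inner_commute)
  qed
  ultimately show ?thesis by (simp add: positive_definite_def)
qed

lemma positive_definite_combination:
  assumes "positive_definite A" "positive_definite B" "0 < a" "0 < b"
  shows "positive_definite (a *\<^sub>R A + b *\<^sub>R B)"
proof -
  have "transpose (a *\<^sub>R A + b *\<^sub>R B) = a *\<^sub>R A + b *\<^sub>R B"
    using assms(1,2) by (simp add: positive_definite_def transpose_def vec_eq_iff)
  then show ?thesis
    using assms positive_definite_pos[OF assms(1)] positive_definite_pos[OF assms(2)]
    by (auto simp: positive_definite_def matrix_vector_mult_add_rdistrib scaleR_matrix_vector_assoc[symmetric]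
        inner_add_right intro!: add_pos_pos)
qed

text \<open>The constant is the minimum of the form on the unit sphere, attained by compactness and
  extended by homogeneity.\<close>

lemma positive_definite_coercive:
  fixes A :: "real ^ 'n ^ 'n::finite"
  assumes "positive_definite A"
  obtains c where "0 < c" "\<And>v. c * (norm v)\<^sup>2 \<le> v \<bullet> (A *v v)"
proof -
  let ?S = "sphere (0 :: real ^ 'n) 1"
  have "?S \<noteq> {}" by simp
  moreover have "continuous_on ?S (\<lambda>v. v \<bullet> (A *v v))"
    by (intro continuous_intros matrix_vector_mult_linear_continuous_on)
  ultimately obtain v0 where v0: "v0 \<in> ?S" "\<And>v. v \<in> ?S \<Longrightarrow> v0 \<bullet> (A *v v0) \<le> v \<bullet> (A *v v)"
    using continuous_attains_inf[OF compact_sphere, of 0 1 "\<lambda>v. v \<bullet> (A *v v)"] by blast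
  show thesis
  proof
    show "0 < v0 \<bullet> (A *v v0)" using v0(1) by (intro positive_definite_pos[OF assms]) auto
    fix v
    show "v0 \<bullet> (A *v v0) * (norm v)\<^sup>2 \<le> v \<bullet> (A *v v)"
    proof (cases "v = 0")
      case False
      then have "v0 \<bullet> (A *v v0) \<le> sgn v \<bullet> (A *v sgn v)"
        by (intro v0(2)) (simp add: norm_sgn)
      then have "v0 \<bullet> (A *v v0) * (norm v)\<^sup>2 \<le> (sgn v \<bullet> (A *v sgn v)) * (norm v)\<^sup>2"
        by (rule mult_right_mono) simp
      also have "\<dots> = (norm v *\<^sub>R sgn v) \<bullet> (A *v (norm v *\<^sub>R sgn v))"
        by (simp add: matrix_vector_mult_scaleR power2_eq_square)
      also have "norm v *\<^sub>R sgn v = v" using False by (simp add: sgn_div_norm)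
      finally show ?thesis .
    qed simp
  qed
qed

text \<open>The convexity gap equals \<open>a * b\<close> times the form at
  \<open>u - v\<close>.\<close>

lemma positive_definite_convex:
  fixes A :: "real ^ 'n ^ 'n::finite"
  assumes "positive_definite A" "0 \<le> a" "0 \<le> b" "a + b = 1"
  shows "(a *\<^sub>R u + b *\<^sub>R v) \<bullet> (A *v (a *\<^sub>R u + b *\<^sub>R v)) \<le> a * (u \<bullet> (A *v u)) + b * (v \<bullet> (A *v v))"
proof -
  have s: "v \<bullet> (A *v u) = u \<bullet> (A *v v)"
    using symmetric_matrix_inner[OF positive_definite_imp_symmetric[OF assms(1)], of v u] by (simp add: inner_commute)
  have b: "b = 1 - a" using assms by simp
  have "a * (u \<bullet> (A *v u)) + b * (v \<bullet> (A *v v)) - (a *\<^sub>R u + b *\<^sub>R v) \<bullet> (A *v (a *\<^sub>R u + b *\<^sub>R v))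
      = a * b * ((u - v) \<bullet> (A *v (u - v)))"
    unfolding b
    by (simp add: s matrix_vector_right_distrib matrix_vector_mult_diff_distrib matrix_vector_mult_scaleR
        inner_add_left inner_add_right inner_diff_left inner_diff_right) (simp add: algebra_simps)
  also have "\<dots> \<ge> 0" using assms positive_definite_nonneg[OF assms(1), of "u - v"] by simp
  finally show ?thesis by simp
qed

section \<open>Stacked vectors, blocks and the Schur complement\<close>

lemma stack_0 [simp]: "stack 0 = 0"
  by (auto simp: stack_def vec_eq_iff split: sum.split)

lemma stack_diff: "stack s - stack s' = stack (s - s')"
  by (auto simp: stack_def vec_eq_iff split: sum.split)

lemma stack_eq_0_iff: "stack s = 0 \<longleftrightarrow> s = 0"
proof
  assume s: "stack s = 0"
  have "fst s = stack s $ Inl ()" "\<And>j. snd s $ j = stack s $ Inr j" by (simp_all add: stack_def)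
  then show "s = 0" by (simp add: s prod_eq_iff vec_eq_iff)
qed simp

lemma sum_unit_plus:
  fixes f :: "unit + 'q::finite \<Rightarrow> real"
  shows "(\<Sum>i\<in>UNIV. f i) = f (Inl ()) + (\<Sum>j\<in>UNIV. f (Inr j))"
proof -
  have "(\<Sum>i\<in>UNIV. f i) = (\<Sum>i\<in>Inl ` UNIV. f i) + (\<Sum>i\<in>Inr ` UNIV. f i)"
    unfolding UNIV_sum by (rule sum.union_disjoint) auto
  then show ?thesis by (simp add: sum.reindex UNIV_unit)
qed

lemma inner_stack: "stack s \<bullet> stack s' = fst s * fst s' + snd s \<bullet> snd s'"
  by (simp add: inner_vec_def sum_unit_plus stack_def)

lemma matrix_vector_mult_stack:
  "V *v stack s = stack (blk_YY V * fst s + blk_YX V \<bullet> snd s, fst s *\<^sub>R blk_XY V + blk_XX V *v snd s)"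
  by (auto simp: vec_eq_iff matrix_vector_mult_def sum_unit_plus stack_def blk_YY_def blk_YX_def blk_XY_def
      blk_XX_def inner_vec_def mult.commute split: sum.split)

lemma symmetric_blk_YX_eq_blk_XY:
  assumes "transpose V = V"
  shows "blk_YX V = blk_XY V"
proof -
  have "V $ i $ j = V $ j $ i" for i j using assms by (metis (no_types) transpose_def vec_lambda_beta)
  then show ?thesis by (simp add: blk_YX_def blk_XY_def vec_eq_iff)
qed

lemma positive_definite_blk_XX:
  assumes "positive_definite V"
  shows "positive_definite (blk_XX V)"
proof -
  have "V $ i $ j = V $ j $ i" for i j
    using positive_definite_imp_symmetric[OF assms] by (metis (no_types) transpose_def vec_lambda_beta)
  then have "transpose (blk_XX V) = blk_XX V"
    by (simp add: blk_XX_def transpose_def vec_eq_iff)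
  moreover have "0 < v \<bullet> (blk_XX V *v v)" if "v \<noteq> 0" for v
    using positive_definite_pos[OF assms, of "stack (0, v)"] that
    by (simp add: stack_eq_0_iff matrix_vector_mult_stack inner_stack zero_prod_def)
  ultimately show ?thesis by (simp add: positive_definite_def)
qed

lemma blk_YY_pos: "positive_definite V \<Longrightarrow> 0 < blk_YY V"
  using positive_definite_pos[of V "stack (1, 0)"]
  by (simp add: stack_eq_0_iff matrix_vector_mult_stack inner_stack zero_prod_def)

text \<open>The test vector is \<open>(1, - B)\<close> with \<open>B\<close> solving
  \<open>blk_XX V *v B = blk_XY V\<close>: the \<open>x\<close> block of its image under
  \<open>V\<close> vanishes and the form equals the Schur complement.\<close>

lemma schur_XX_pos:
  fixes V :: "real ^ (unit + 'q) ^ (unit + 'q::finite)"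
  assumes "positive_definite V"
  shows "0 < schur_XX V"
proof -
  define B where "B = matrix_inv (blk_XX V) *v blk_XY V"
  have B: "blk_XX V *v B = blk_XY V"
    unfolding B_def by (intro matrix_inv_right_apply positive_definite_invertible positive_definite_blk_XX assms)
  have "stack (1, - B) \<bullet> (V *v stack (1, - B)) = schur_XX V"
    using symmetric_matrix_inner[OF positive_definite_imp_symmetric[OF positive_definite_blk_XX[OF assms]], of B B]
    by (simp add: matrix_vector_mult_stack inner_stack B schur_XX_def B_def[symmetric] vec.neg)
  then show ?thesis
    using positive_definite_pos[OF assms, of "stack (1, - B)"] by (simp add: stack_eq_0_iff zero_prod_def)
qed

text \<open>No block inverse is formed: the solution of \<open>V *v z = stack (s - s')\<close> is
  written down as \<open>(a, A *v \<xi> - a *\<^sub>R B)\<close> and verified. Here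
  \<open>\<eta> - B \<bullet> \<xi>\<close> is the residual of \<open>\<eta>\<close> after linear
  regression on \<open>\<xi>\<close>, and \<open>a\<close> is this residual divided by its variance,
  the Schur complement.\<close>

lemma mahalanobis_cost_eq:
  fixes V :: "real ^ (unit + 'q) ^ (unit + 'q::finite)"
  assumes V: "positive_definite V"
  defines "A \<equiv> matrix_inv (blk_XX V)"
  shows "mahalanobis_cost V s s' =
    (fst (s - s') - (A *v blk_XY V) \<bullet> snd (s - s'))\<^sup>2 / schur_XX V + snd (s - s') \<bullet> (A *v snd (s - s'))"
proof -
  define \<eta> \<xi> B where "\<eta> = fst (s - s')" and "\<xi> = snd (s - s')" and "B = A *v blk_XY V"
  define a where "a = (\<eta> - B \<bullet> \<xi>) / schur_XX V"
  have XX: "positive_definite (blk_XX V)" by (rule positive_definite_blk_XX[OF V])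
  have S: "schur_XX V > 0" by (rule schur_XX_pos[OF V])
  have symA: "transpose A = A" unfolding A_def
    by (intro positive_definite_imp_symmetric positive_definite_matrix_inv XX)
  have inv: "blk_XX V *v (A *v v) = v" for v
    unfolding A_def by (intro matrix_inv_right_apply positive_definite_invertible XX)
  have YX: "blk_YX V = blk_XY V" by (intro symmetric_blk_YX_eq_blk_XY positive_definite_imp_symmetric V)
  have Bx: "blk_XY V \<bullet> (A *v v) = B \<bullet> v" for v unfolding B_def by (rule symmetric_matrix_inner[OF symA])
  have "V *v stack (a, A *v \<xi> - a *\<^sub>R B) = stack (s - s')"
  proof -
    have "blk_YY V * a + blk_XY V \<bullet> (A *v \<xi> - a *\<^sub>R B) = schur_XX V * a + B \<bullet> \<xi>"
      by (simp add: inner_diff_right Bx schur_XX_def YX A_def[symmetric] B_def[symmetric] algebra_simps)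
    also have "\<dots> = \<eta>" using S by (simp add: a_def)
    finally have "blk_YY V * a + blk_XY V \<bullet> (A *v \<xi> - a *\<^sub>R B) = \<eta>" .
    moreover have "a *\<^sub>R blk_XY V + blk_XX V *v (A *v \<xi> - a *\<^sub>R B) = \<xi>"
      by (simp add: matrix_vector_mult_diff_distrib matrix_vector_mult_scaleR B_def inv)
    ultimately show ?thesis
      by (simp only: matrix_vector_mult_stack YX fst_conv snd_conv) (simp only: \<eta>_def \<xi>_def prod.collapse)
  qed
  then have "matrix_inv V *v stack (s - s') = stack (a, A *v \<xi> - a *\<^sub>R B)"
    by (intro matrix_inv_eqI positive_definite_invertible V)
  then have "mahalanobis_cost V s s' = \<eta> * a + \<xi> \<bullet> (A *v \<xi> - a *\<^sub>R B)"
    by (simp add: mahalanobis_cost_def stack_diff inner_stack \<eta>_def \<xi>_def)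
  also have "\<dots> = (\<eta> - B \<bullet> \<xi>) * a + \<xi> \<bullet> (A *v \<xi>)"
    by (simp add: inner_diff_right algebra_simps inner_commute)
  finally show ?thesis by (simp add: \<eta>_def \<xi>_def a_def B_def power2_eq_square)
qed

section \<open>Duality for the finite-dimensional problem\<close>

text \<open>The optimisation over mean displacements, free of measures: \<open>A1\<close> and
  \<open>A2\<close> stand for the inverse \<open>XX\<close> blocks, \<open>S1\<close> and
  \<open>S2\<close> for the Schur complements, \<open>w\<close> for \<open>Vo\<close>.\<close>

locale shift_problem =
  fixes A1 A2 :: "real ^ 'q ^ 'q::finite" and S1 S2 :: real and w :: "real ^ 'q"
  assumes A1: "positive_definite A1" and A2: "positive_definite A2" and S1: "0 < S1" and S2: "0 < S2"
begin

text \<open>Here \<open>t1\<close> is minus the residual displacement of \<open>y1\<close>, since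
  the objective rewards lowering \<open>y1\<close>. The squares hide this sign, and both variables
  enter \<open>gains\<close> with a plus.\<close>

definition feasible :: "real \<Rightarrow> real \<Rightarrow> real \<Rightarrow> real \<Rightarrow> real ^ 'q \<Rightarrow> bool" where
  "feasible d1 d2 t1 t2 \<xi> \<longleftrightarrow> t1\<^sup>2 / S1 + \<xi> \<bullet> (A1 *v \<xi>) \<le> d1 \<and> t2\<^sup>2 / S2 + \<xi> \<bullet> (A2 *v \<xi>) \<le> d2"

definition gains :: "real \<Rightarrow> real \<Rightarrow> real set" where
  "gains d1 d2 = {t1 + t2 + w \<bullet> \<xi> |t1 t2 \<xi>. feasible d1 d2 t1 t2 \<xi>}"

definition shift_value :: "real \<Rightarrow> real \<Rightarrow> real" where
  "shift_value d1 d2 = Sup (gains d1 d2)"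

text \<open>This is the maximum of the Lagrangian: \<open>t - l * t\<^sup>2 / S\<close> peaks at
  \<open>S / (4 * l)\<close>, and \<open>w \<bullet> \<xi>\<close> minus the form of
  \<open>l1 *\<^sub>R A1 + l2 *\<^sub>R A2\<close> peaks at a quarter of the inverse form of
  \<open>w\<close>.\<close>

definition dual :: "real \<Rightarrow> real \<Rightarrow> real \<Rightarrow> real \<Rightarrow> real" where
  "dual l1 l2 d1 d2 = l1 * d1 + l2 * d2 + 1 / (4 * l1) * S1 + 1 / (4 * l2) * S2 +
    1 / 4 * (w \<bullet> (matrix_inv (l1 *\<^sub>R A1 + l2 *\<^sub>R A2) *v w))"

lemma feasible_0: "0 \<le> d1 \<Longrightarrow> 0 \<le> d2 \<Longrightarrow> feasible d1 d2 0 0 0"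
  by (simp add: feasible_def)

lemma gains_nonempty: "0 \<le> d1 \<Longrightarrow> 0 \<le> d2 \<Longrightarrow> gains d1 d2 \<noteq> {}"
  using feasible_0[of d1 d2] by (fastforce simp: gains_def)

text \<open>Weak duality by completing squares: the slack consists of multiples of
  \<open>(2 * l * t - S)\<^sup>2\<close>, a quarter of the form of \<open>M\<close> at
  \<open>2 *\<^sub>R \<xi> - u\<close>, and the unspent radii weighted by the multipliers.\<close>

lemma gain_le_dual:
  assumes "feasible d1 d2 t1 t2 \<xi>" "0 < l1" "0 < l2"
  shows "t1 + t2 + w \<bullet> \<xi> \<le> dual l1 l2 d1 d2"
proof -
  define M u where "M = l1 *\<^sub>R A1 + l2 *\<^sub>R A2" and "u = matrix_inv M *v w"
  have M: "positive_definite M" unfolding M_def by (intro positive_definite_combination A1 A2 assms)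
  have u: "M *v u = w" unfolding u_def by (intro matrix_inv_right_apply positive_definite_invertible M)
  have AMGM: "t \<le> l * (t\<^sup>2 / S) + 1 / (4 * l) * S" if "0 < l" "0 < S" for t l S :: real
  proof -
    have "l * (t\<^sup>2 / S) + 1 / (4 * l) * S - t = (2 * l * t - S)\<^sup>2 / (4 * l * S)"
      using that by (simp add: field_simps power2_eq_square)
    moreover have "\<dots> \<ge> 0" using that by simp
    ultimately show ?thesis by linarith
  qed
  have "(2 *\<^sub>R \<xi> - u) \<bullet> (M *v (2 *\<^sub>R \<xi> - u)) = 4 * (\<xi> \<bullet> (M *v \<xi>)) - 4 * (w \<bullet> \<xi>) + w \<bullet> u"
    using symmetric_matrix_inner[OF positive_definite_imp_symmetric[OF M], of u \<xi>] u
    by (simp add: matrix_vector_mult_diff_distrib matrix_vector_mult_scaleR inner_diff_left inner_diff_right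
        inner_commute)
  then have "w \<bullet> \<xi> \<le> \<xi> \<bullet> (M *v \<xi>) + 1 / 4 * (w \<bullet> u)"
    using positive_definite_nonneg[OF M, of "2 *\<^sub>R \<xi> - u"] by simp
  also have "\<xi> \<bullet> (M *v \<xi>) = l1 * (\<xi> \<bullet> (A1 *v \<xi>)) + l2 * (\<xi> \<bullet> (A2 *v \<xi>))"
    by (simp add: M_def matrix_vector_mult_add_rdistrib scaleR_matrix_vector_assoc[symmetric] inner_add_right)
  finally have "w \<bullet> \<xi> \<le> l1 * (\<xi> \<bullet> (A1 *v \<xi>)) + l2 * (\<xi> \<bullet> (A2 *v \<xi>)) + 1 / 4 * (w \<bullet> u)" .
  moreover have "l1 * (t1\<^sup>2 / S1 + \<xi> \<bullet> (A1 *v \<xi>)) \<le> l1 * d1" "l2 * (t2\<^sup>2 / S2 + \<xi> \<bullet> (A2 *v \<xi>)) \<le> l2 * d2"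
    using assms by (auto simp: feasible_def)
  ultimately show ?thesis
    using AMGM[OF assms(2) S1, of t1] AMGM[OF assms(3) S2, of t2]
    by (simp add: dual_def M_def u_def distrib_left)
qed

text \<open>The squares completed in \<open>gain_le_dual\<close> vanish at
  \<open>t = S / (2 * l)\<close> and \<open>\<xi> = (1/2) *\<^sub>R u\<close>. The radii enter the
  Lagrangian only as an additive term, so they are set to zero.\<close>

lemma dual_attained:
  assumes "0 < l1" "0 < l2"
  obtains t1 t2 \<xi> where
    "t1 + t2 + w \<bullet> \<xi> - l1 * (t1\<^sup>2 / S1 + \<xi> \<bullet> (A1 *v \<xi>)) - l2 * (t2\<^sup>2 / S2 + \<xi> \<bullet> (A2 *v \<xi>)) = dual l1 l2 0 0"
proof
  define M u where "M = l1 *\<^sub>R A1 + l2 *\<^sub>R A2" and "u = matrix_inv M *v w"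
  define \<xi> where "\<xi> = (1/2) *\<^sub>R u"
  have M: "positive_definite M" unfolding M_def by (intro positive_definite_combination A1 A2 assms)
  have u: "M *v u = w" unfolding u_def by (intro matrix_inv_right_apply positive_definite_invertible M)
  have "l1 * (\<xi> \<bullet> (A1 *v \<xi>)) + l2 * (\<xi> \<bullet> (A2 *v \<xi>)) = \<xi> \<bullet> (M *v \<xi>)"
    by (simp add: M_def matrix_vector_mult_add_rdistrib scaleR_matrix_vector_assoc[symmetric] inner_add_right)
  also have "\<dots> = 1 / 4 * (w \<bullet> u)"
    by (simp add: \<xi>_def matrix_vector_mult_scaleR u inner_commute)
  finally have *: "l1 * (\<xi> \<bullet> (A1 *v \<xi>)) + l2 * (\<xi> \<bullet> (A2 *v \<xi>)) = 1 / 4 * (w \<bullet> u)" .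
  have **: "S / (2 * l) - l * ((S / (2 * l))\<^sup>2 / S) = 1 / (4 * l) * S" if "0 < l" "0 < S" for S l :: real
    using that by (simp add: field_simps power2_eq_square)
  have "w \<bullet> \<xi> = 1 / 2 * (w \<bullet> u)" by (simp add: \<xi>_def)
  with * show "S1 / (2 * l1) + S2 / (2 * l2) + w \<bullet> \<xi> - l1 * ((S1 / (2 * l1))\<^sup>2 / S1 + \<xi> \<bullet> (A1 *v \<xi>))
      - l2 * ((S2 / (2 * l2))\<^sup>2 / S2 + \<xi> \<bullet> (A2 *v \<xi>)) = dual l1 l2 0 0"
    using **[OF assms(1) S1] **[OF assms(2) S2]
    by (simp add: dual_def M_def u_def distrib_left)
qed

lemma bdd_above_gains: "bdd_above (gains d1 d2)"
  using gain_le_dual[of d1 d2 _ _ _ 1 1] by (auto simp: gains_def intro!: bdd_aboveI)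

lemma gain_le_shift_value: "feasible d1 d2 t1 t2 \<xi> \<Longrightarrow> t1 + t2 + w \<bullet> \<xi> \<le> shift_value d1 d2"
  unfolding shift_value_def by (intro cSup_upper bdd_above_gains) (auto simp: gains_def)

lemma shift_value_le:
  assumes "0 \<le> d1" "0 \<le> d2" "\<And>t1 t2 \<xi>. feasible d1 d2 t1 t2 \<xi> \<Longrightarrow> t1 + t2 + w \<bullet> \<xi> \<le> b"
  shows "shift_value d1 d2 \<le> b"
  unfolding shift_value_def using assms by (intro cSup_least gains_nonempty) (auto simp: gains_def)

lemma shift_value_le_dual:
  "0 \<le> d1 \<Longrightarrow> 0 \<le> d2 \<Longrightarrow> 0 < l1 \<Longrightarrow> 0 < l2 \<Longrightarrow> shift_value d1 d2 \<le> dual l1 l2 d1 d2"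
  by (intro shift_value_le gain_le_dual)

lemma shift_value_mono:
  "0 \<le> d1 \<Longrightarrow> 0 \<le> d2 \<Longrightarrow> d1 \<le> e1 \<Longrightarrow> d2 \<le> e2 \<Longrightarrow> shift_value d1 d2 \<le> shift_value e1 e2"
  by (intro shift_value_le gain_le_shift_value) (auto simp: feasible_def)

lemma feasible_sqrt:
  assumes "0 \<le> d1" "0 \<le> d2"
  shows "feasible d1 d2 (sqrt S1 * sqrt d1) (sqrt S2 * sqrt d2) 0"
  using assms S1 S2 by (simp add: feasible_def power_mult_distrib)

lemma shift_value_ge:
  "0 \<le> d1 \<Longrightarrow> 0 \<le> d2 \<Longrightarrow> sqrt S1 * sqrt d1 + sqrt S2 * sqrt d2 \<le> shift_value d1 d2"
  using gain_le_shift_value[OF feasible_sqrt] by simp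

text \<open>The same \<open>\<xi>\<close> occurs in both constraints, so its norm is controlled by
  the smaller radius. If that radius is zero, the last term disappears and the bound meets
  \<open>shift_value_ge\<close>. The constant \<open>c\<close> is the smaller of the coercivity
  constants of \<open>A1\<close> and \<open>A2\<close>.\<close>

lemma shift_value_upper:
  obtains c where "0 < c" "\<And>d1 d2. 0 \<le> d1 \<Longrightarrow> 0 \<le> d2 \<Longrightarrow>
    shift_value d1 d2 \<le> sqrt S1 * sqrt d1 + sqrt S2 * sqrt d2 + norm w * sqrt (min d1 d2 / c)"
proof -
  obtain c1 c2 where c1: "0 < c1" "\<And>v. c1 * (norm v)\<^sup>2 \<le> v \<bullet> (A1 *v v)"
    and c2: "0 < c2" "\<And>v. c2 * (norm v)\<^sup>2 \<le> v \<bullet> (A2 *v v)"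
    using positive_definite_coercive[OF A1] positive_definite_coercive[OF A2] by metis
  define c where "c = min c1 c2"
  have c: "0 < c" "\<And>v. c * (norm v)\<^sup>2 \<le> v \<bullet> (A1 *v v)" "\<And>v. c * (norm v)\<^sup>2 \<le> v \<bullet> (A2 *v v)"
    using c1 c2 by (auto simp: c_def intro: order_trans[OF mult_right_mono[OF min.cobounded1]]
        order_trans[OF mult_right_mono[OF min.cobounded2]])
  show thesis
  proof (rule that[OF c(1)])
    fix d1 d2 :: real assume d: "0 \<le> d1" "0 \<le> d2"
    show "shift_value d1 d2 \<le> sqrt S1 * sqrt d1 + sqrt S2 * sqrt d2 + norm w * sqrt (min d1 d2 / c)"
    proof (rule shift_value_le[OF d])
      fix t1 t2 \<xi> assume f: "feasible d1 d2 t1 t2 \<xi>"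
      have "t1\<^sup>2 / S1 \<ge> 0" "t2\<^sup>2 / S2 \<ge> 0" using S1 S2 by auto
      with f c(2)[of \<xi>] c(3)[of \<xi>] have "c * (norm \<xi>)\<^sup>2 \<le> min d1 d2"
        by (auto simp: feasible_def)
      then have "norm \<xi> \<le> sqrt (min d1 d2 / c)"
        using c(1) by (intro real_le_rsqrt) (simp add: field_simps)
      then have "w \<bullet> \<xi> \<le> norm w * sqrt (min d1 d2 / c)"
        by (intro order_trans[OF norm_cauchy_schwarz] mult_left_mono) auto
      moreover have "t1\<^sup>2 / S1 \<le> d1" "t2\<^sup>2 / S2 \<le> d2"
        using f positive_definite_nonneg[OF A1, of \<xi>] positive_definite_nonneg[OF A2, of \<xi>]
        by (auto simp: feasible_def)
      then have "t1\<^sup>2 \<le> S1 * d1" "t2\<^sup>2 \<le> S2 * d2"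
        using S1 S2 by (auto simp: pos_divide_le_eq mult.commute)
      then have "t1 \<le> sqrt (S1 * d1)" "t2 \<le> sqrt (S2 * d2)" by (auto intro: real_le_rsqrt)
      ultimately show "t1 + t2 + w \<bullet> \<xi> \<le> sqrt S1 * sqrt d1 + sqrt S2 * sqrt d2 + norm w * sqrt (min d1 d2 / c)"
        by (simp add: real_sqrt_mult)
    qed
  qed
qed

text \<open>Multiplying a feasible point by \<open>\<theta>\<close> multiplies its gain by
  \<open>\<theta>\<close> but its costs by \<open>\<theta>\<^sup>2 \<le> \<theta>\<close>.\<close>

lemma shift_value_scale:
  assumes "0 \<le> d1" "0 \<le> d2" "0 < \<theta>" "\<theta> \<le> 1"
  shows "\<theta> * shift_value d1 d2 \<le> shift_value (\<theta> * d1) (\<theta> * d2)"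
proof -
  have "shift_value d1 d2 \<le> shift_value (\<theta> * d1) (\<theta> * d2) / \<theta>"
  proof (rule shift_value_le[OF assms(1,2)])
    fix t1 t2 \<xi> assume f: "feasible d1 d2 t1 t2 \<xi>"
    have "(\<theta> * t)\<^sup>2 / S + (\<theta> *\<^sub>R \<xi>) \<bullet> (A *v (\<theta> *\<^sub>R \<xi>)) \<le> \<theta> * d"
      if "t\<^sup>2 / S + \<xi> \<bullet> (A *v \<xi>) \<le> d" "0 \<le> d" for t S d and A :: "real ^ 'q ^ 'q"
    proof -
      have "(\<theta> * t)\<^sup>2 / S + (\<theta> *\<^sub>R \<xi>) \<bullet> (A *v (\<theta> *\<^sub>R \<xi>)) = \<theta> * (\<theta> * (t\<^sup>2 / S + \<xi> \<bullet> (A *v \<xi>)))"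
        by (simp add: matrix_vector_mult_scaleR power2_eq_square algebra_simps)
      also have "\<dots> \<le> \<theta> * (\<theta> * d)" using that assms by (intro mult_left_mono) auto
      also have "\<dots> \<le> \<theta> * (1 * d)" using that assms by (intro mult_left_mono mult_right_mono) auto
      finally show ?thesis by simp
    qed
    then have "feasible (\<theta> * d1) (\<theta> * d2) (\<theta> * t1) (\<theta> * t2) (\<theta> *\<^sub>R \<xi>)"
      using f assms by (simp add: feasible_def)
    from gain_le_shift_value[OF this] show "t1 + t2 + w \<bullet> \<xi> \<le> shift_value (\<theta> * d1) (\<theta> * d2) / \<theta>"
      using assms by (simp add: field_simps)
  qed
  then show ?thesis using assms by (simp add: field_simps)
qed

text \<open>Positive radii serve as the Slater condition: they prevent the separating hyperplane
  from being vertical, so its normal can be rescaled into multipliers.\<close>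

lemma strong_duality_interior:
  assumes d: "0 < d1" "0 < d2"
  obtains l1 l2 where "0 < l1" "0 < l2" "dual l1 l2 d1 d2 \<le> shift_value d1 d2"
proof -
  let ?p = "shift_value d1 d2"
  \<comment> \<open>\<open>C\<close> collects the radii together with all levels not above an
    attained gain; it is convex because the costs are convex and the gain is linear.
    \<open>D\<close> is the open vertical ray above the value at the given radii.\<close>
  define C where "C = {(a, b, v) |a b v. \<exists>t1 t2 \<xi>. feasible a b t1 t2 \<xi> \<and> v \<le> t1 + t2 + w \<bullet> \<xi>}"
  define D where "D = {d1} \<times> {d2} \<times> {?p<..}"
  have CI: "(a, b, v) \<in> C" if "feasible a b t1 t2 \<xi>" "v \<le> t1 + t2 + w \<bullet> \<xi>" for a b v t1 t2 \<xi>
    using that by (auto simp: C_def)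
  have sq: "(s * x + t * y)\<^sup>2 / S \<le> s * (x\<^sup>2 / S) + t * (y\<^sup>2 / S)"
    if "0 \<le> s" "0 \<le> t" "s + t = 1" "0 < S" for s t x y S :: real
  proof -
    have "s * (x\<^sup>2 / S) + t * (y\<^sup>2 / S) - (s * x + t * y)\<^sup>2 / S = s * t * ((x - y)\<^sup>2 / S)"
      using that(4) unfolding eq_diff_eq[THEN iffD2, OF that(3)] by (simp add: field_simps power2_eq_square)
    also have "\<dots> \<ge> 0" using that by simp
    finally show ?thesis by simp
  qed
  have "convex C"
  proof (rule convexI)
    fix X Y s t assume "X \<in> C" "Y \<in> C" and st: "(0::real) \<le> s" "0 \<le> t" "s + t = 1"
    then obtain a b v t1 t2 \<xi> a' b' v' t1' t2' \<xi>' where X: "X = (a, b, v)" and Y: "Y = (a', b', v')"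
      and f: "feasible a b t1 t2 \<xi>" "v \<le> t1 + t2 + w \<bullet> \<xi>"
      and f': "feasible a' b' t1' t2' \<xi>'" "v' \<le> t1' + t2' + w \<bullet> \<xi>'"
      by (auto simp: C_def)
    have comb: "(s * x + t * y)\<^sup>2 / S + (s *\<^sub>R \<xi> + t *\<^sub>R \<xi>') \<bullet> (A *v (s *\<^sub>R \<xi> + t *\<^sub>R \<xi>')) \<le> s * d + t * e"
      if "positive_definite A" "0 < S" "x\<^sup>2 / S + \<xi> \<bullet> (A *v \<xi>) \<le> d" "y\<^sup>2 / S + \<xi>' \<bullet> (A *v \<xi>') \<le> e"
      for x y S d e and A :: "real ^ 'q ^ 'q"
    proof -
      have "s * (x\<^sup>2 / S + \<xi> \<bullet> (A *v \<xi>)) + t * (y\<^sup>2 / S + \<xi>' \<bullet> (A *v \<xi>')) \<le> s * d + t * e"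
        using that st by (intro add_mono mult_left_mono)
      then show ?thesis
        using sq[OF st that(2), of x y] positive_definite_convex[OF that(1) st, of \<xi> \<xi>']
        by (simp add: distrib_left)
    qed
    have "feasible (s * a + t * a') (s * b + t * b') (s * t1 + t * t1') (s * t2 + t * t2') (s *\<^sub>R \<xi> + t *\<^sub>R \<xi>')"
      using f f' comb[OF A1 S1] comb[OF A2 S2] by (simp add: feasible_def)
    moreover have "s * v + t * v' \<le> s * (t1 + t2 + w \<bullet> \<xi>) + t * (t1' + t2' + w \<bullet> \<xi>')"
      using f f' st by (intro add_mono mult_left_mono)
    ultimately show "s *\<^sub>R X + t *\<^sub>R Y \<in> C"
      unfolding X Y by (auto intro!: CI simp: inner_add_right algebra_simps)
  qed
  moreover have "convex D" unfolding D_def by (intro convex_Times) auto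
  moreover have "(0, 0, 0) \<in> C" by (rule CI[OF feasible_0]) auto
  moreover have "D \<noteq> {}" by (auto simp: D_def)
  moreover have "C \<inter> D = {}" using gain_le_shift_value by (fastforce simp: C_def D_def)
  ultimately obtain n k where "n \<noteq> 0" and nC: "\<And>x. x \<in> C \<Longrightarrow> n \<bullet> x \<le> k" and nD: "\<And>x. x \<in> D \<Longrightarrow> n \<bullet> x \<ge> k"
    using separating_hyperplane_sets[of C D] by blast
  obtain n1 n2 n3 where n: "n = (n1, n2, n3)" by (cases n)
  have C: "n1 * a + n2 * b + n3 * v \<le> k" if "feasible a b t1 t2 \<xi>" "v \<le> t1 + t2 + w \<bullet> \<xi>" for a b v t1 t2 \<xi>
    using nC[OF CI[OF that]] by (simp add: n)
  have D: "k \<le> n1 * d1 + n2 * d2 + n3 * v" if "?p < v" for v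
    using nD[of "(d1, d2, v)"] that by (simp add: n D_def)
  \<comment> \<open>\<open>C\<close> extends without bound towards larger radii and towards lower
    levels, which fixes the signs of the three components of the normal.\<close>
  have ray: "m \<le> 0" if "\<And>a. 0 \<le> a \<Longrightarrow> m * a \<le> k" for m :: real
  proof (rule ccontr)
    assume "\<not> m \<le> 0"
    then show False using that[of "(\<bar>k\<bar> + 1) / m"] by simp
  qed
  have n12: "n1 \<le> 0" "n2 \<le> 0"
    using ray[of n1] C[OF feasible_0, of _ 0 0] ray[of n2] C[OF feasible_0, of 0 _ 0] by auto
  have n3: "0 \<le> n3"
    using ray[of "- n3"] C[OF feasible_0, of 0 0 "- _"] by auto
  have k: "0 \<le> k" using C[OF feasible_0, of 0 0 0] by simp
  \<comment> \<open>The origin belongs to \<open>C\<close>, so \<open>k\<close> is nonnegative. With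
    \<open>n3 = 0\<close>, positive radii and nonpositive \<open>n1\<close>, \<open>n2\<close>, the
    bound on \<open>D\<close> would make the whole normal vanish.\<close>
  have "n3 \<noteq> 0"
  proof
    assume "n3 = 0"
    then have "0 \<le> n1 * d1 + n2 * d2" using D[of "?p + 1"] k by simp
    moreover have "n1 * d1 \<le> 0" "n2 * d2 \<le> 0" using n12 d by (auto intro: mult_nonpos_nonneg)
    ultimately have "n1 * d1 = 0" "n2 * d2 = 0" by linarith+
    then show False using \<open>n \<noteq> 0\<close> \<open>n3 = 0\<close> d by (simp add: n zero_prod_def)
  qed
  with n3 have n3: "0 < n3" by simp
  define l1 l2 where "l1 = - n1 / n3" and "l2 = - n2 / n3"
  \<comment> \<open>\<open>D\<close> has only levels strictly above the value; letting the excess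
    tend to zero reaches the value itself.\<close>
  have kp: "k \<le> n1 * d1 + n2 * d2 + n3 * ?p"
  proof (rule field_le_epsilon)
    fix e :: real assume "0 < e"
    then show "k \<le> n1 * d1 + n2 * d2 + n3 * ?p + e"
      using D[of "?p + e / n3"] n3 by (simp add: distrib_left)
  qed
  have le: "t1 + t2 + w \<bullet> \<xi> - l1 * a - l2 * b \<le> ?p - l1 * d1 - l2 * d2" if "feasible a b t1 t2 \<xi>" for a b t1 t2 \<xi>
  proof -
    have "n3 * (t1 + t2 + w \<bullet> \<xi> - l1 * a - l2 * b) \<le> n3 * (?p - l1 * d1 - l2 * d2)"
      using C[OF that order_refl] kp n3 by (simp add: l1_def l2_def algebra_simps)
    then show ?thesis using n3 by simp
  qed
  let ?K = "?p - l1 * d1 - l2 * d2"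
  \<comment> \<open>With a zero multiplier \<open>t1\<close> could grow at no price: the point
    \<open>t1 = ?K + 1\<close>, with the radius it requires, already violates
    \<open>le\<close>.\<close>
  have "l1 \<noteq> 0"
  proof
    assume "l1 = 0"
    then show False using le[of "(?K + 1)\<^sup>2 / S1" 0 "?K + 1" 0 0] by (simp add: feasible_def)
  qed
  moreover have "l2 \<noteq> 0"
  proof
    assume "l2 = 0"
    then show False using le[of 0 "(?K + 1)\<^sup>2 / S2" 0 "?K + 1" 0] by (simp add: feasible_def)
  qed
  moreover have "l1 \<ge> 0" "l2 \<ge> 0" using n12 n3 by (auto simp: l1_def l2_def divide_nonpos_pos)
  ultimately have l: "0 < l1" "0 < l2" by auto
  \<comment> \<open>Since \<open>le\<close> holds at arbitrary radii, it may be applied at exactly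
    the costs of the Lagrangian maximiser, which turns it into the dual bound.\<close>
  obtain t1 t2 \<xi> where
    "t1 + t2 + w \<bullet> \<xi> - l1 * (t1\<^sup>2 / S1 + \<xi> \<bullet> (A1 *v \<xi>)) - l2 * (t2\<^sup>2 / S2 + \<xi> \<bullet> (A2 *v \<xi>)) = dual l1 l2 0 0"
    using dual_attained[OF l] .
  then have "dual l1 l2 0 0 \<le> ?K"
    using le[of "t1\<^sup>2 / S1 + \<xi> \<bullet> (A1 *v \<xi>)" "t2\<^sup>2 / S2 + \<xi> \<bullet> (A2 *v \<xi>)" t1 t2 \<xi>] by (simp add: feasible_def)
  then have "dual l1 l2 d1 d2 \<le> ?p" by (simp add: dual_def)
  with l that show thesis by blast
qed

text \<open>On the boundary both radii are enlarged by \<open>e\<close>. The dual increases with the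
  radii, so multipliers found for the enlarged problem bound the original infimum. The bound of
  \<open>shift_value_upper\<close> tends to a value that is attained with
  \<open>\<xi> = 0\<close>.\<close>

theorem strong_duality:
  assumes d: "0 \<le> d1" "0 \<le> d2"
  shows "ereal (shift_value d1 d2) = (INF (l1, l2) \<in> {0<..} \<times> {0<..}. ereal (dual l1 l2 d1 d2))"
proof (rule antisym)
  show "ereal (shift_value d1 d2) \<le> (INF (l1, l2) \<in> {0<..} \<times> {0<..}. ereal (dual l1 l2 d1 d2))"
    using shift_value_le_dual[OF d] by (auto intro!: INF_greatest)
  let ?I = "INF (l1, l2) \<in> {0<..} \<times> {0<..}. ereal (dual l1 l2 d1 d2)"
  have I: "?I \<le> ereal (dual l1 l2 d1 d2)" if "0 < l1" "0 < l2" for l1 l2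
    using that by (intro INF_lower2[of "(l1, l2)"]) auto
  show "?I \<le> ereal (shift_value d1 d2)"
  proof (cases "0 < d1 \<and> 0 < d2")
    case True
    then obtain l1 l2 where "0 < l1" "0 < l2" "dual l1 l2 d1 d2 \<le> shift_value d1 d2"
      using strong_duality_interior by blast
    with I[of l1 l2] show ?thesis by (meson ereal_less_eq(3) order_trans)
  next
    case False
    then have m: "min d1 d2 = 0" using d by auto
    obtain c where c: "0 < c" "\<And>d1 d2. 0 \<le> d1 \<Longrightarrow> 0 \<le> d2 \<Longrightarrow>
      shift_value d1 d2 \<le> sqrt S1 * sqrt d1 + sqrt S2 * sqrt d2 + norm w * sqrt (min d1 d2 / c)"
      using shift_value_upper by blast
    \<comment> \<open>The bound of \<open>shift_value_upper\<close> at the enlarged radii, whose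
      minimum is \<open>e\<close> because one original radius is zero.\<close>
    define b where "b e = sqrt S1 * sqrt (d1 + e) + sqrt S2 * sqrt (d2 + e) + norm w * sqrt (e / c)" for e
    have "?I \<le> ereal (b e)" if e: "0 < e" for e
    proof -
      obtain l1 l2 where l: "0 < l1" "0 < l2" "dual l1 l2 (d1 + e) (d2 + e) \<le> shift_value (d1 + e) (d2 + e)"
        by (rule strong_duality_interior[of "d1 + e" "d2 + e"]) (use d e in auto)
      have "dual l1 l2 d1 d2 \<le> dual l1 l2 (d1 + e) (d2 + e)"
        using l that by (auto simp: dual_def intro!: add_mono mult_left_mono)
      also have "\<dots> \<le> b e"
      proof -
        have "min (d1 + e) (d2 + e) = e" using m by (auto simp: min_def split: if_splits)
        then show ?thesis using l(3) c(2)[of "d1 + e" "d2 + e"] d that by (simp add: b_def)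
      qed
      finally show ?thesis using I[OF l(1,2)] by (meson ereal_less_eq(3) order_trans)
    qed
    then have "eventually (\<lambda>e. ?I \<le> ereal (b e)) (at_right 0)"
      by (intro eventually_at_rightI[of 0 1]) auto
    moreover have "((\<lambda>e. ereal (b e)) \<longlongrightarrow> ereal (b 0)) (at_right 0)"
    proof (rule tendsto_ereal, unfold b_def)
      show "((\<lambda>e. sqrt S1 * sqrt (d1 + e) + sqrt S2 * sqrt (d2 + e) + norm w * sqrt (e / c)) \<longlongrightarrow>
        sqrt S1 * sqrt (d1 + 0) + sqrt S2 * sqrt (d2 + 0) + norm w * sqrt (0 / c)) (at_right 0)"
        using c(1) by (intro tendsto_intros) auto
    qed
    ultimately have "?I \<le> ereal (b 0)"
      by (intro tendsto_lowerbound[of "\<lambda>e. ereal (b e)"]) auto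
    also have "b 0 \<le> shift_value d1 d2" using shift_value_ge[OF d] by (simp add: b_def)
    finally show ?thesis by simp
  qed
qed

lemma continuous_on_shift_value: "continuous_on ({0..} \<times> {0..}) (\<lambda>d. shift_value (fst d) (snd d))"
proof (unfold continuous_on, intro ballI)
  fix d :: "real \<times> real" assume d: "d \<in> {0..} \<times> {0..}"
  let ?F = "at d within {0..} \<times> {0..}" and ?P = "\<lambda>d. shift_value (fst d) (snd d)"
  have [tendsto_intros]: "(fst \<longlongrightarrow> fst d) ?F" "(snd \<longlongrightarrow> snd d) ?F"
    by (auto intro!: tendsto_intros)
  have Q: "eventually (\<lambda>x. 0 \<le> fst x \<and> 0 \<le> snd x) ?F"
    by (auto simp: eventually_at_filter intro!: always_eventually)
  have d': "0 \<le> fst d" "0 \<le> snd d" using d by auto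
  show "(?P \<longlongrightarrow> ?P d) ?F"
  proof (rule order_tendstoI)
    fix a assume "?P d < a"
    then have "(INF (l1, l2) \<in> {0<..} \<times> {0<..}. ereal (dual l1 l2 (fst d) (snd d))) < ereal a"
      unfolding strong_duality[OF d', symmetric] by simp
    then obtain l1 l2 where l: "0 < l1" "0 < l2" "dual l1 l2 (fst d) (snd d) < a"
      by (auto simp: INF_less_iff)
    have "((\<lambda>x. dual l1 l2 (fst x) (snd x)) \<longlongrightarrow> dual l1 l2 (fst d) (snd d)) ?F"
      unfolding dual_def by (intro tendsto_intros)
    from order_tendstoD(2)[OF this l(3)] Q show "eventually (\<lambda>x. ?P x < a) ?F"
      by eventually_elim (meson shift_value_le_dual[OF _ _ l(1,2)] le_less_trans)
  next
    fix a assume a: "a < ?P d"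
    have "((\<lambda>\<theta>. \<theta> * ?P d) \<longlongrightarrow> 1 * ?P d) (at_left 1)" by (intro tendsto_intros)
    then have "eventually (\<lambda>\<theta>. a < \<theta> * ?P d) (at_left 1)"
      using a by (intro order_tendstoD(1)) simp_all
    moreover have "eventually (\<lambda>\<theta>::real. 0 < \<theta> \<and> \<theta> < 1) (at_left 1)"
      by (intro eventually_at_leftI[of 0]) auto
    ultimately have "eventually (\<lambda>\<theta>. a < \<theta> * ?P d \<and> 0 < \<theta> \<and> \<theta> < 1) (at_left 1)"
      by (rule eventually_conj)
    from eventually_happens[OF this] obtain \<theta> where \<theta>: "a < \<theta> * ?P d" "0 < \<theta>" "\<theta> < 1"
      by auto
    \<comment> \<open>Nearby radii dominate \<open>\<theta>\<close> times the radii at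
      \<open>d\<close> in each coordinate: a positive coordinate leaves a strict margin, and a zero
      coordinate needs only nonnegativity. Monotonicity and scaling can then be combined.\<close>
    have ev: "eventually (\<lambda>x. \<theta> * p d \<le> p x) ?F"
      if "(p \<longlongrightarrow> p d) ?F" "0 \<le> p d" "eventually (\<lambda>x. 0 \<le> p x) ?F" for p :: "real \<times> real \<Rightarrow> real"
    proof (cases "p d = 0")
      case False
      then have "\<theta> * p d < p d" using that(2) \<theta> by simp
      from order_tendstoD(1)[OF that(1) this] show ?thesis by eventually_elim simp
    qed (use that(3) in simp)
    have "eventually (\<lambda>x. \<theta> * fst d \<le> fst x) ?F" "eventually (\<lambda>x. \<theta> * snd d \<le> snd x) ?F"
      using Q d' by (auto intro!: ev tendsto_intros elim: eventually_mono)
    then show "eventually (\<lambda>x. a < ?P x) ?F"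
    proof eventually_elim
      case (elim x)
      have "a < \<theta> * ?P d" by (rule \<theta>)
      also have "\<dots> \<le> shift_value (\<theta> * fst d) (\<theta> * snd d)" using \<theta> d' by (intro shift_value_scale) auto
      also have "\<dots> \<le> ?P x" using elim \<theta> d' by (intro shift_value_mono) auto
      finally show ?case .
    qed
  qed
qed

end

section \<open>Mean displacements and translations\<close>

lemma borel_probs_distr:
  assumes "\<mu> \<in> borel_probs" "f \<in> borel_measurable borel"
  shows "distr \<mu> borel f \<in> borel_probs"
  using assms by (auto simp: borel_probs_def cong: measurable_cong_sets intro: prob_space.prob_space_distr)

lemma borel_probs_measurable: "\<mu> \<in> borel_probs \<Longrightarrow> f \<in> borel_measurable borel \<Longrightarrow> f \<in> borel_measurable \<mu>"
  by (simp add: borel_probs_def cong: measurable_cong_sets)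

lemma borel_measurable_fst: "(fst :: 'a::topological_space \<times> 'b::topological_space \<Rightarrow> 'a) \<in> borel_measurable borel"
  and borel_measurable_snd: "(snd :: 'a \<times> 'b \<Rightarrow> 'b) \<in> borel_measurable borel"
  by (intro borel_measurable_continuous_onI continuous_intros)+

text \<open>
  A coupling whose cost is almost optimal is averaged with the affine minorant of \<open>q\<close> at the mean
  displacement \<open>m\<close>; the quadratic lower bound makes the displacement integrable.
\<close>

lemma transport_cost_mean_displacement:
  fixes \<mu> \<nu> :: "'a::euclidean_space measure"
  assumes \<mu>: "\<mu> \<in> borel_probs" and int: "integrable \<mu> (\<lambda>s. s)"
    and c: "\<And>s s'. c s s' = q (s - s')" and q: "q \<in> borel_measurable borel"
    and k: "0 < k" "\<And>v. k * (norm v)\<^sup>2 \<le> q v"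
    and subgradient: "\<And>m. \<exists>g. bounded_linear g \<and> (\<forall>v. q m + g (v - m) \<le> q v)"
    and le: "transport_cost c \<mu> \<nu> \<le> ennreal d" and d: "0 \<le> d"
  shows "integrable \<nu> (\<lambda>s. s)" and "q ((\<integral>s. s \<partial>\<mu>) - (\<integral>s. s \<partial>\<nu>)) \<le> d"
proof -
  have *: "integrable \<nu> (\<lambda>s. s) \<and> q ((\<integral>s. s \<partial>\<mu>) - (\<integral>s. s \<partial>\<nu>)) \<le> d + e" if e: "0 < e" for e
  proof -
    have "transport_cost c \<mu> \<nu> < ennreal (d + e)"
      by (rule le_less_trans[OF le]) (use d e in \<open>simp add: ennreal_less_iff\<close>)
    then obtain \<pi> where \<pi>: "\<pi> \<in> couplings \<mu> \<nu>"
      and less: "(\<integral>\<^sup>+ z. ennreal (c (fst z) (snd z)) \<partial>\<pi>) < ennreal (d + e)"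
      unfolding transport_cost_def INF_less_iff by blast
    have \<pi>p: "\<pi> \<in> borel_probs" and mu: "distr \<pi> borel fst = \<mu>" and nu: "distr \<pi> borel snd = \<nu>"
      using \<pi> by (auto simp: couplings_def)
    interpret prob_space \<pi> using \<pi>p by (simp add: borel_probs_def)
    note [measurable] = borel_probs_measurable[OF \<pi>p borel_measurable_fst] borel_probs_measurable[OF \<pi>p borel_measurable_snd] q
    let ?D = "\<lambda>z :: 'a \<times> 'a. fst z - snd z"
    have q0: "0 \<le> q v" for v by (rule order_trans[OF _ k(2)]) (use k(1) in simp)
    have qint: "integrable \<pi> (\<lambda>z. q (?D z))"
    proof (rule integrableI_nonneg)
      show "(\<integral>\<^sup>+ z. ennreal (q (?D z)) \<partial>\<pi>) < \<infinity>" using less_trans[OF less ennreal_less_top] by (simp add: c)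
    qed (use q0 in auto)
    have "ennreal (\<integral>z. q (?D z) \<partial>\<pi>) = (\<integral>\<^sup>+ z. ennreal (q (?D z)) \<partial>\<pi>)"
      using qint q0 by (intro nn_integral_eq_integral[symmetric]) auto
    then have "ennreal (\<integral>z. q (?D z) \<partial>\<pi>) < ennreal (d + e)" using less by (simp add: c)
    then have qle: "(\<integral>z. q (?D z) \<partial>\<pi>) < d + e"
      using q0 by (subst (asm) ennreal_less_iff) (auto intro: integral_nonneg_AE)
    have "integrable \<pi> (\<lambda>z. 1 + q (?D z) / k)" using qint by simp
    then have Dint: "integrable \<pi> ?D"
    proof (rule Bochner_Integration.integrable_bound)
      show "AE z in \<pi>. norm (?D z) \<le> norm (1 + q (?D z) / k)"
      proof (rule AE_I2)
        fix z
        have "2 * norm (?D z) \<le> 1 + (norm (?D z))\<^sup>2"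
          using zero_le_power2[of "norm (?D z) - 1"] by (simp add: power2_diff)
        then have "norm (?D z) \<le> 1 + (norm (?D z))\<^sup>2"
          using norm_ge_zero[of "?D z"] by linarith
        also have "(norm (?D z))\<^sup>2 \<le> q (?D z) / k" using k by (simp add: pos_le_divide_eq mult.commute)
        finally show "norm (?D z) \<le> norm (1 + q (?D z) / k)" by simp
      qed
    qed measurable
    have fint: "integrable \<pi> fst"
      using int unfolding mu[symmetric] by (subst (asm) integrable_distr_eq) auto
    \<comment> \<open>Nothing is assumed about the moments of \<open>\<nu>\<close>; the second
      coordinate is the first minus an integrable displacement.\<close>
    have sint: "integrable \<pi> snd"
      using Bochner_Integration.integrable_diff[OF fint Dint] by simp
    then have "integrable \<nu> (\<lambda>s. s)"
      unfolding nu[symmetric] by (subst integrable_distr_eq) auto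
    moreover have "q ((\<integral>s. s \<partial>\<mu>) - (\<integral>s. s \<partial>\<nu>)) \<le> d + e"
    proof -
      let ?m = "(\<integral>z. fst z \<partial>\<pi>) - (\<integral>z. snd z \<partial>\<pi>)"
      have m: "(\<integral>s. s \<partial>\<mu>) - (\<integral>s. s \<partial>\<nu>) = ?m"
        unfolding mu[symmetric] nu[symmetric] by (simp add: integral_distr)
      obtain g where g: "bounded_linear g" "\<And>v. q ?m + g (v - ?m) \<le> q v" using subgradient by blast
      have Dm: "integrable \<pi> (\<lambda>z. ?D z - ?m)" using Dint by simp
      have "(\<integral>z. ?D z - ?m \<partial>\<pi>) = 0" using fint sint by (simp add: prob_space)
      then have "(\<integral>z. g (?D z - ?m) \<partial>\<pi>) = 0"
        using integral_bounded_linear[OF g(1) Dm] linear_0[OF bounded_linear.linear[OF g(1)]] by simp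
      moreover have gint: "integrable \<pi> (\<lambda>z. g (?D z - ?m))"
        by (rule integrable_bounded_linear[OF g(1) Dm])
      ultimately have "q ?m = (\<integral>z. q ?m + g (?D z - ?m) \<partial>\<pi>)" by (simp add: prob_space)
      also have "\<dots> \<le> (\<integral>z. q (?D z) \<partial>\<pi>)" using gint qint g(2) by (intro integral_mono) auto
      finally show ?thesis using qle m by simp
    qed
    ultimately show ?thesis by blast
  qed
  show "integrable \<nu> (\<lambda>s. s)" using *[OF zero_less_one] by (rule conjunct1)
  show "q ((\<integral>s. s \<partial>\<mu>) - (\<integral>s. s \<partial>\<nu>)) \<le> d"
    by (rule field_le_epsilon) (rule conjunct2[OF *])
qed

text \<open>The deterministic coupling \<open>s \<mapsto> (s, s + v)\<close> is admissible, and a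
  pointwise bound on its cost integrates to the same bound under a probability measure.\<close>

lemma transport_cost_translation:
  fixes \<mu> :: "'a::euclidean_space measure"
  assumes \<mu>: "\<mu> \<in> borel_probs" and c: "\<And>s. c s (s + v) \<le> d" and m: "(\<lambda>z. c (fst z) (snd z)) \<in> borel_measurable borel"
  shows "transport_cost c \<mu> (distr \<mu> borel (\<lambda>s. s + v)) \<le> ennreal d"
proof -
  interpret prob_space \<mu> using \<mu> by (simp add: borel_probs_def)
  have s\<mu>: "sets \<mu> = sets borel" using \<mu> by (simp add: borel_probs_def)
  have g0: "(\<lambda>s. (s, s + v)) \<in> borel_measurable borel" by (intro borel_measurable_continuous_onI continuous_intros)
  have g: "(\<lambda>s. (s, s + v)) \<in> borel_measurable \<mu>" by (rule borel_probs_measurable[OF \<mu> g0])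
  let ?\<pi> = "distr \<mu> borel (\<lambda>s. (s, s + v))"
  have "distr ?\<pi> borel fst = distr \<mu> \<mu> (\<lambda>s. s)"
    by (subst distr_distr[OF borel_measurable_fst g]) (intro distr_cong, auto simp: s\<mu>)
  then have "?\<pi> \<in> couplings \<mu> (distr \<mu> borel (\<lambda>s. s + v))"
    using borel_probs_distr[OF \<mu> g0]
    by (simp add: couplings_def distr_distr[OF borel_measurable_snd g] comp_def distr_id)
  then have "transport_cost c \<mu> (distr \<mu> borel (\<lambda>s. s + v)) \<le> (\<integral>\<^sup>+ z. ennreal (c (fst z) (snd z)) \<partial>?\<pi>)"
    unfolding transport_cost_def by (rule INF_lower)
  also have "\<dots> = (\<integral>\<^sup>+ s. ennreal (c s (s + v)) \<partial>\<mu>)"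
    using m by (subst nn_integral_distr[OF g]) auto
  also have "\<dots> \<le> (\<integral>\<^sup>+ s. ennreal d \<partial>\<mu>)" using c by (intro nn_integral_mono ennreal_leI) auto
  also have "\<dots> = ennreal d" by (simp add: emeasure_space_1)
  finally show ?thesis .
qed

section \<open>Mahalanobis costs as coercive convex functions of the displacement\<close>

lemma linear_stack: "linear stack"
  by (rule linearI) (auto simp: stack_def vec_eq_iff split: sum.split)

lemma continuous_on_stack [continuous_intros]:
  "continuous_on X f \<Longrightarrow> continuous_on X (\<lambda>x. stack (f x))"
  by (rule continuous_on_compose2[OF linear_continuous_on[OF linear_stack[unfolded linear_conv_bounded_linear], of UNIV]]) auto

lemma mahalanobis_cost_diff: "mahalanobis_cost V s s' = mahalanobis_cost V (s - s') 0"
  by (simp add: mahalanobis_cost_def stack_diff)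

lemma continuous_on_mahalanobis_cost [continuous_intros]:
  "continuous_on X f \<Longrightarrow> continuous_on X g \<Longrightarrow> continuous_on X (\<lambda>x. mahalanobis_cost V (f x) (g x))"
  unfolding mahalanobis_cost_def
  by (intro continuous_intros matrix_vector_mult_linear_continuous_on[THEN continuous_on_compose2]) auto

lemma mahalanobis_cost_coercive:
  fixes V :: "real ^ (unit + 'q) ^ (unit + 'q::finite)"
  assumes "positive_definite V"
  obtains k where "0 < k" "\<And>v. k * (norm v)\<^sup>2 \<le> mahalanobis_cost V v 0"
proof -
  obtain k where k: "0 < k" "\<And>v. k * (norm v)\<^sup>2 \<le> v \<bullet> (matrix_inv V *v v)"
    using positive_definite_coercive[OF positive_definite_matrix_inv[OF assms]] by blast
  show thesis
  proof (rule that[OF k(1)])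
    fix v :: "real \<times> (real ^ 'q)"
    \<comment> \<open>Stacking is an isometry, so the coercivity constant of the inverse matrix
      carries over unchanged.\<close>
    have "norm (stack v) = norm v"
      by (simp add: norm_eq_sqrt_inner inner_stack inner_prod_def)
    then show "k * (norm v)\<^sup>2 \<le> mahalanobis_cost V v 0"
      using k(2)[of "stack v"] by (simp add: mahalanobis_cost_def)
  qed
qed

text \<open>The minorant is the tangent at \<open>m\<close>, with gradient twice the inverse matrix
  applied to \<open>stack m\<close>; the gap is the quadratic form at \<open>v - m\<close>.\<close>

lemma mahalanobis_cost_subgradient:
  assumes "positive_definite V"
  shows "\<exists>g. bounded_linear g \<and> (\<forall>v. mahalanobis_cost V m 0 + g (v - m) \<le> mahalanobis_cost V v 0)"
proof (intro exI conjI allI)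
  let ?W = "matrix_inv V"
  have W: "positive_definite ?W" by (rule positive_definite_matrix_inv[OF assms])
  show "bounded_linear (\<lambda>v. 2 * ((?W *v stack m) \<bullet> stack v))"
    by (intro bounded_linear_mult_right[THEN bounded_linear_compose] bounded_linear_inner_right[THEN bounded_linear_compose]
        linear_conv_bounded_linear[THEN iffD1] linear_stack)
  fix v
  have "0 \<le> stack (v - m) \<bullet> (?W *v stack (v - m))" by (rule positive_definite_nonneg[OF W])
  then show "mahalanobis_cost V m 0 + 2 * ((?W *v stack m) \<bullet> stack (v - m)) \<le> mahalanobis_cost V v 0"
    using symmetric_matrix_inner[OF positive_definite_imp_symmetric[OF W], of "stack m" "stack v"]
    by (simp add: mahalanobis_cost_def stack_diff[symmetric] matrix_vector_mult_diff_distrib inner_diff_left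
        inner_diff_right inner_commute)
qed

lemma mahalanobis_transport_mean:
  fixes \<mu> \<nu> :: "(real \<times> (real ^ 'q::finite)) measure"
  assumes V: "positive_definite V" and \<mu>: "\<mu> \<in> borel_probs" and int: "integrable \<mu> (\<lambda>s. s)"
    and le: "transport_cost (mahalanobis_cost V) \<mu> \<nu> \<le> ennreal d" and d: "0 \<le> d"
  shows "integrable \<nu> (\<lambda>s. s)" and "mahalanobis_cost V (\<integral>s. s \<partial>\<mu>) (\<integral>s. s \<partial>\<nu>) \<le> d"
proof -
  obtain k where k: "0 < k" "\<And>v. k * (norm v)\<^sup>2 \<le> mahalanobis_cost V v 0"
    using mahalanobis_cost_coercive[OF V] by blast
  have m: "(\<lambda>v. mahalanobis_cost V v 0) \<in> borel_measurable borel"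
    by (intro borel_measurable_continuous_onI continuous_intros)
  note * = transport_cost_mean_displacement[OF \<mu> int mahalanobis_cost_diff m k mahalanobis_cost_subgradient[OF V] le d]
  show "integrable \<nu> (\<lambda>s. s)" by (rule *)
  show "mahalanobis_cost V (\<integral>s. s \<partial>\<mu>) (\<integral>s. s \<partial>\<nu>) \<le> d"
    by (subst mahalanobis_cost_diff) (rule *)
qed

lemma mahalanobis_Y_transport_mean:
  fixes \<mu> \<nu> :: "real measure" and V :: "real ^ (unit + 'q) ^ (unit + 'q::finite)"
  assumes V: "positive_definite V" and \<mu>: "\<mu> \<in> borel_probs" and int: "integrable \<mu> (\<lambda>s. s)"
    and le: "transport_cost (mahalanobis_cost_Y V) \<mu> \<nu> \<le> ennreal d" and d: "0 \<le> d"
  shows "integrable \<nu> (\<lambda>s. s)" and "\<bar>(\<integral>s. s \<partial>\<mu>) - (\<integral>s. s \<partial>\<nu>)\<bar> \<le> sqrt (blk_YY V) * sqrt d"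
proof -
  note YY = blk_YY_pos[OF V]
  let ?q = "\<lambda>v::real. v\<^sup>2 / blk_YY V"
  have c: "mahalanobis_cost_Y V s s' = ?q (s - s')" for s s'
    by (simp add: mahalanobis_cost_Y_def power2_eq_square field_simps)
  have sub: "\<exists>g. bounded_linear g \<and> (\<forall>v. ?q m + g (v - m) \<le> ?q v)" for m
  proof (intro exI conjI allI)
    show "bounded_linear (\<lambda>v. 2 * m / blk_YY V * v)" by (rule bounded_linear_mult_right)
    fix v
    have "?q v - (?q m + 2 * m / blk_YY V * (v - m)) = ?q (v - m)"
      using YY by (simp add: field_simps power2_eq_square)
    moreover have "\<dots> \<ge> 0" using YY by simp
    ultimately show "?q m + 2 * m / blk_YY V * (v - m) \<le> ?q v" by linarith
  qed
  have m: "?q \<in> borel_measurable borel" by measurable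
  have k: "1 / blk_YY V * (norm v)\<^sup>2 \<le> ?q v" for v by simp
  have k0: "0 < 1 / blk_YY V" using YY by simp
  note * = transport_cost_mean_displacement[where q="?q", OF \<mu> int c m k0 k sub le d]
  show "integrable \<nu> (\<lambda>s. s)" by (rule *)
  have "((\<integral>s. s \<partial>\<mu>) - (\<integral>s. s \<partial>\<nu>))\<^sup>2 \<le> blk_YY V * d"
    using *(2) YY by (simp add: pos_divide_le_eq mult.commute)
  then show "\<bar>(\<integral>s. s \<partial>\<mu>) - (\<integral>s. s \<partial>\<nu>)\<bar> \<le> sqrt (blk_YY V) * sqrt d"
    using real_le_rsqrt[of "\<bar>(\<integral>s. s \<partial>\<mu>) - (\<integral>s. s \<partial>\<nu>)\<bar>" "blk_YY V * d"] by (simp add: real_sqrt_mult)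
qed

section \<open>Integrals of pairs and of image laws\<close>

lemma integrable_Pair_iff:
  fixes f :: "'s \<Rightarrow> 'a::euclidean_space" and g :: "'s \<Rightarrow> 'b::euclidean_space"
  shows "integrable M (\<lambda>s. (f s, g s)) \<longleftrightarrow> integrable M f \<and> integrable M g"
proof (intro iffI conjI)
  assume i: "integrable M (\<lambda>s. (f s, g s))"
  show "integrable M f" using integrable_bounded_linear[OF bounded_linear_fst i] by simp
  show "integrable M g" using integrable_bounded_linear[OF bounded_linear_snd i] by simp
next
  assume i: "integrable M f \<and> integrable M g"
  have l: "bounded_linear (\<lambda>a::'a. (a, 0::'b))" "bounded_linear (\<lambda>b::'b. (0::'a, b))"
    by (intro bounded_linear_Pair bounded_linear_ident bounded_linear_zero)+
  have "integrable M (\<lambda>s. (f s, 0) + (0, g s))"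
    using integrable_bounded_linear[OF l(1), of M f] integrable_bounded_linear[OF l(2), of M g] i
    by (intro Bochner_Integration.integrable_add) simp_all
  then show "integrable M (\<lambda>s. (f s, g s))" by simp
qed

lemma integral_Pair:
  fixes f :: "'s \<Rightarrow> 'a::euclidean_space" and g :: "'s \<Rightarrow> 'b::euclidean_space"
  assumes "integrable M f" "integrable M g"
  shows "(\<integral>s. (f s, g s) \<partial>M) = (\<integral>s. f s \<partial>M, \<integral>s. g s \<partial>M)"
proof -
  have i: "integrable M (\<lambda>s. (f s, g s))" using assms by (simp add: integrable_Pair_iff)
  show ?thesis
    using integral_bounded_linear[OF bounded_linear_fst i] integral_bounded_linear[OF bounded_linear_snd i]
    by (simp add: prod_eq_iff)
qed

lemma borel_measurable_ident: "(\<lambda>x. x) \<in> borel_measurable borel"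
  by simp

lemma borel_measurable_translation: "(\<lambda>s. s + v) \<in> borel_measurable borel"
  for v :: "'a::euclidean_space"
  by (intro borel_measurable_continuous_onI continuous_intros)

lemma distr_distr_borel_probs:
  assumes "\<mu> \<in> borel_probs" "f \<in> borel_measurable borel" "g \<in> borel_measurable borel"
  shows "distr (distr \<mu> borel f) borel g = distr \<mu> borel (\<lambda>z. g (f z))"
  using distr_distr[OF assms(3) borel_probs_measurable[OF assms(1,2)]] by (simp add: comp_def)

lemma (in finite_measure) integrable_of_integrable_norm_square:
  fixes f :: "'a \<Rightarrow> 'b::euclidean_space"
  assumes [measurable]: "f \<in> borel_measurable M" and "integrable M (\<lambda>x. (norm (f x))\<^sup>2)"
  shows "integrable M f"
  using square_integrable_imp_integrable[OF _ assms(2)] by (subst integrable_norm_iff[symmetric]) auto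

lemma borel_measurable_y1x: "(\<lambda>(y1, y2, x). (y1, x)) \<in> borel_measurable borel"
  and borel_measurable_y2x: "(\<lambda>(y1, y2, x). (y2, x)) \<in> borel_measurable borel"
  unfolding case_prod_unfold by (intro borel_measurable_continuous_onI continuous_intros)+

text \<open>
  The displacement of the means turns a measure of the ambiguity set into a feasible point of the
  finite-dimensional problem; conversely a feasible point is realised by translating a gluing of
  the reference measures.
\<close>

lemma overlap_primal_eq_shift_value:
  fixes \<mu>13 \<mu>23 :: "(real \<times> (real ^ 'q::finite)) measure"
    and V1 V2 :: "real ^ (unit + 'q) ^ (unit + 'q)"
  assumes \<mu>13: "\<mu>13 \<in> borel_probs" and \<mu>23: "\<mu>23 \<in> borel_probs"
    and eq: "distr \<mu>13 borel snd = distr \<mu>23 borel snd"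
    and int1: "integrable \<mu>13 (\<lambda>s. s)" and int2: "integrable \<mu>23 (\<lambda>s. s)"
    and V1: "positive_definite V1" and V2: "positive_definite V2"
    and d: "0 \<le> d1" "0 \<le> d2"
  defines "A1 \<equiv> matrix_inv (blk_XX V1)" and "A2 \<equiv> matrix_inv (blk_XX V2)"
  shows "overlap_primal (\<lambda>y1 y2. y2 - y1) (mahalanobis_cost V1) (mahalanobis_cost V2) \<mu>13 \<mu>23 (d1, d2) =
    ereal ((\<integral>s. fst s \<partial>\<mu>23) - (\<integral>s. fst s \<partial>\<mu>13) +
      shift_problem.shift_value A1 A2 (schur_XX V1) (schur_XX V2) (A2 *v blk_XY V2 - A1 *v blk_XY V1) d1 d2)"
    (is "?I = ereal (?E + _)")
proof -
  let ?f = "\<lambda>(y1, y2, x :: real ^ 'q). y2 - y1 :: real"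
  let ?A = "overlap_ambiguity (mahalanobis_cost V1) (mahalanobis_cost V2) \<mu>13 \<mu>23 (d1, d2)"
  define B1 B2 where "B1 = A1 *v blk_XY V1" and "B2 = A2 *v blk_XY V2"
  interpret shift_problem A1 A2 "schur_XX V1" "schur_XX V2" "B2 - B1"
    unfolding A1_def A2_def
    by unfold_locales (intro positive_definite_matrix_inv positive_definite_blk_XX schur_XX_pos V1 V2)+
  have cost1: "mahalanobis_cost V1 s s' =
      (fst (s - s') - B1 \<bullet> snd (s - s'))\<^sup>2 / schur_XX V1 + snd (s - s') \<bullet> (A1 *v snd (s - s'))" for s s'
    unfolding B1_def A1_def by (rule mahalanobis_cost_eq[OF V1])
  have cost2: "mahalanobis_cost V2 s s' =
      (fst (s - s') - B2 \<bullet> snd (s - s'))\<^sup>2 / schur_XX V2 + snd (s - s') \<bullet> (A2 *v snd (s - s'))" for s s'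
    unfolding B2_def A2_def by (rule mahalanobis_cost_eq[OF V2])
  have mean: "fst (\<integral>s. s \<partial>M) = (\<integral>s. fst s \<partial>M)" "snd (\<integral>s. s \<partial>M) = (\<integral>s. snd s \<partial>M)"
    if "integrable M (\<lambda>s. s)" for M :: "(real \<times> (real ^ 'q)) measure"
    using integral_bounded_linear[OF bounded_linear_fst that] integral_bounded_linear[OF bounded_linear_snd that]
    by simp_all
  \<comment> \<open>Equal \<open>x\<close> marginals give equal \<open>x\<close> means, so both
    constraints involve one and the same mean displacement of \<open>x\<close>.\<close>
  have "(\<integral>s. snd s \<partial>\<mu>13) = (\<integral>x. x \<partial>distr \<mu>13 borel snd)"
    by (rule integral_distr[symmetric]) (intro borel_probs_measurable[OF \<mu>13] borel_measurable_snd, simp)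
  also have "\<dots> = (\<integral>s. snd s \<partial>\<mu>23)"
    unfolding eq by (rule integral_distr) (intro borel_probs_measurable[OF \<mu>23] borel_measurable_snd, simp)
  finally have EX: "(\<integral>s. snd s \<partial>\<mu>13) = (\<integral>s. snd s \<partial>\<mu>23)" .
  have marg: "(integrable \<gamma> (\<lambda>z. fst z) \<and> integrable \<gamma> (\<lambda>z. fst (snd z)) \<and> integrable \<gamma> (\<lambda>z. snd (snd z))) \<and>
      (\<integral>s. s \<partial>distr \<gamma> borel (\<lambda>(y1, y2, x). (y1, x))) = (\<integral>z. fst z \<partial>\<gamma>, \<integral>z. snd (snd z) \<partial>\<gamma>) \<and>
      (\<integral>s. s \<partial>distr \<gamma> borel (\<lambda>(y1, y2, x). (y2, x))) = (\<integral>z. fst (snd z) \<partial>\<gamma>, \<integral>z. snd (snd z) \<partial>\<gamma>)"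
    if \<gamma>: "\<gamma> \<in> borel_probs"
      and i: "integrable (distr \<gamma> borel (\<lambda>(y1, y2, x). (y1, x))) (\<lambda>s. s)"
        "integrable (distr \<gamma> borel (\<lambda>(y1, y2, x). (y2, x))) (\<lambda>s. s)"
    for \<gamma> :: "(real \<times> real \<times> (real ^ 'q)) measure"
  proof -
    note m = borel_probs_measurable[OF \<gamma> borel_measurable_y1x] borel_probs_measurable[OF \<gamma> borel_measurable_y2x]
    have "integrable \<gamma> (\<lambda>z. (fst z, snd (snd z)))" "integrable \<gamma> (\<lambda>z. (fst (snd z), snd (snd z)))"
      using i(1)[unfolded integrable_distr_eq[OF m(1) borel_measurable_ident]]
        i(2)[unfolded integrable_distr_eq[OF m(2) borel_measurable_ident]]
      by (simp_all only: case_prod_unfold)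
    then have "integrable \<gamma> fst" "integrable \<gamma> (\<lambda>z. fst (snd z))" "integrable \<gamma> (\<lambda>z. snd (snd z))"
      unfolding integrable_Pair_iff by simp_all
    then show ?thesis
      unfolding integral_distr[OF m(1) borel_measurable_ident] integral_distr[OF m(2) borel_measurable_ident]
      by (simp add: case_prod_unfold integral_Pair del: prod.collapse)
  qed
  have val: "ext_integral \<gamma> ?f = ereal ((\<integral>z. fst (snd z) \<partial>\<gamma>) - (\<integral>z. fst z \<partial>\<gamma>))"
    if "integrable \<gamma> (\<lambda>z. fst z)" "integrable \<gamma> (\<lambda>z. fst (snd z))" for \<gamma> :: "(real \<times> real \<times> (real ^ 'q)) measure"
    using that by (simp add: ext_integral_eq_lebesgue_integral case_prod_unfold)
  have upper: "ext_integral \<gamma> ?f \<le> ereal (?E + shift_value d1 d2)" if \<gamma>: "\<gamma> \<in> ?A" for \<gamma>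
  proof -
    let ?\<nu>1 = "distr \<gamma> borel (\<lambda>(y1, y2, x). (y1, x))" and ?\<nu>2 = "distr \<gamma> borel (\<lambda>(y1, y2, x). (y2, x))"
    have \<gamma>p: "\<gamma> \<in> borel_probs" and t1: "transport_cost (mahalanobis_cost V1) \<mu>13 ?\<nu>1 \<le> ennreal d1"
      and t2: "transport_cost (mahalanobis_cost V2) \<mu>23 ?\<nu>2 \<le> ennreal d2"
      using \<gamma> by (auto simp: overlap_ambiguity_def)
    note n1 = mahalanobis_transport_mean[OF V1 \<mu>13 int1 t1 d(1)]
    note n2 = mahalanobis_transport_mean[OF V2 \<mu>23 int2 t2 d(2)]
    note g = marg[OF \<gamma>p n1(1) n2(1)]
    \<comment> \<open>With these orientations, \<open>t1 = a1 + B1 \<bullet> \<xi>\<close> and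
      \<open>t2 = - (a2 + B2 \<bullet> \<xi>)\<close> make the terms in \<open>\<xi>\<close> cancel
      in the gain. What is left, \<open>a1 - a2\<close>, is the excess of the objective over its
      reference value.\<close>
    define a1 a2 \<xi> where "a1 = (\<integral>s. fst s \<partial>\<mu>13) - (\<integral>z. fst z \<partial>\<gamma>)"
      and "a2 = (\<integral>s. fst s \<partial>\<mu>23) - (\<integral>z. fst (snd z) \<partial>\<gamma>)"
      and "\<xi> = (\<integral>z. snd (snd z) \<partial>\<gamma>) - (\<integral>s. snd s \<partial>\<mu>23)"
    have \<xi>: "(\<integral>s. snd s \<partial>\<mu>23) - (\<integral>z. snd (snd z) \<partial>\<gamma>) = - \<xi>" by (simp add: \<xi>_def)
    have "(a1 + B1 \<bullet> \<xi>)\<^sup>2 / schur_XX V1 + \<xi> \<bullet> (A1 *v \<xi>) \<le> d1"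
      using n1(2) unfolding cost1 fst_diff snd_diff mean[OF int1] EX using g
      by (simp add: \<xi> a1_def vec.neg)
    moreover have "(a2 + B2 \<bullet> \<xi>)\<^sup>2 / schur_XX V2 + \<xi> \<bullet> (A2 *v \<xi>) \<le> d2"
      using n2(2) unfolding cost2 fst_diff snd_diff mean[OF int2] using g
      by (simp add: \<xi> a2_def vec.neg)
    ultimately have "feasible d1 d2 (a1 + B1 \<bullet> \<xi>) (- (a2 + B2 \<bullet> \<xi>)) \<xi>"
      unfolding feasible_def power2_minus by simp
    from gain_le_shift_value[OF this] have "a1 - a2 \<le> shift_value d1 d2"
      by (simp add: inner_diff_left)
    then show ?thesis using val g by (simp add: a1_def a2_def)
  qed
  have lower: "ereal (?E + (t1 + t2 + (B2 - B1) \<bullet> \<xi>)) \<le> ?I" if f: "feasible d1 d2 t1 t2 \<xi>" for t1 t2 \<xi>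
  proof -
    obtain \<gamma>0 :: "(real \<times> real \<times> (real ^ 'q)) measure" where \<gamma>0: "\<gamma>0 \<in> borel_probs"
      and m1: "distr \<gamma>0 borel (\<lambda>(y1, y2, x). (y1, x)) = \<mu>13" and m2: "distr \<gamma>0 borel (\<lambda>(y1, y2, x). (y2, x)) = \<mu>23"
      using gluing[OF \<mu>13 \<mu>23 eq] by blast
    interpret prob_space \<gamma>0 using \<gamma>0 by (simp add: borel_probs_def)
    \<comment> \<open>The shifts solve \<open>e1 - B1 \<bullet> \<xi> = - t1\<close> and
      \<open>e2 - B2 \<bullet> \<xi> = t2\<close>, so \<open>e2 - e1\<close> is the gain. They are
      written with \<open>- \<xi>\<close> to match \<open>s - s'\<close> in the cost.\<close>
    define e1 e2 where "e1 = - (t1 + B1 \<bullet> (- \<xi>))" and "e2 = t2 - B2 \<bullet> (- \<xi>)"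
    note g0 = marg[OF \<gamma>0, unfolded m1 m2, OF int1 int2]
    let ?s = "\<lambda>z. z + (e1, e2, \<xi>)"
    have s0: "?s \<in> borel_measurable borel" by (rule borel_measurable_translation)
    note s = borel_probs_measurable[OF \<gamma>0 s0]
    have y2: "(\<lambda>z. fst (snd z)) \<in> borel_measurable (borel :: (real \<times> real \<times> (real ^ 'q)) measure)"
      by (intro borel_measurable_continuous_onI continuous_intros)
    let ?\<gamma> = "distr \<gamma>0 borel ?s"
    have "distr ?\<gamma> borel (\<lambda>(y1, y2, x). (y1, x)) = distr \<mu>13 borel (\<lambda>s. s + (e1, \<xi>))"
      unfolding m1[symmetric] distr_distr_borel_probs[OF \<gamma>0 s0 borel_measurable_y1x]
        distr_distr_borel_probs[OF \<gamma>0 borel_measurable_y1x borel_measurable_translation]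
      by (simp add: case_prod_unfold)
    moreover have "distr ?\<gamma> borel (\<lambda>(y1, y2, x). (y2, x)) = distr \<mu>23 borel (\<lambda>s. s + (e2, \<xi>))"
      unfolding m2[symmetric] distr_distr_borel_probs[OF \<gamma>0 s0 borel_measurable_y2x]
        distr_distr_borel_probs[OF \<gamma>0 borel_measurable_y2x borel_measurable_translation]
      by (simp add: case_prod_unfold)
    moreover have "transport_cost (mahalanobis_cost V1) \<mu>13 (distr \<mu>13 borel (\<lambda>s. s + (e1, \<xi>))) \<le> ennreal d1"
    proof (rule transport_cost_translation[OF \<mu>13])
      show "mahalanobis_cost V1 s (s + (e1, \<xi>)) \<le> d1" for s
        using f unfolding cost1 by (simp add: feasible_def e1_def vec.neg)
    qed (intro borel_measurable_continuous_onI continuous_intros)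
    moreover have "transport_cost (mahalanobis_cost V2) \<mu>23 (distr \<mu>23 borel (\<lambda>s. s + (e2, \<xi>))) \<le> ennreal d2"
    proof (rule transport_cost_translation[OF \<mu>23])
      show "mahalanobis_cost V2 s (s + (e2, \<xi>)) \<le> d2" for s
        using f unfolding cost2 by (simp add: feasible_def e2_def vec.neg power2_commute)
    qed (intro borel_measurable_continuous_onI continuous_intros)
    ultimately have "?\<gamma> \<in> ?A"
      using borel_probs_distr[OF \<gamma>0 s0] by (simp add: overlap_ambiguity_def)
    then have "ext_integral ?\<gamma> ?f \<le> ?I"
      unfolding overlap_primal_def by (rule SUP_upper)
    moreover have "integrable ?\<gamma> (\<lambda>z. fst z)" "integrable ?\<gamma> (\<lambda>z. fst (snd z))"
      unfolding integrable_distr_eq[OF s borel_measurable_fst] integrable_distr_eq[OF s y2] using g0 by simp_all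
    moreover have "(\<integral>z. fst z \<partial>?\<gamma>) = (\<integral>z. fst z \<partial>\<gamma>0) + e1" "(\<integral>z. fst (snd z) \<partial>?\<gamma>) = (\<integral>z. fst (snd z) \<partial>\<gamma>0) + e2"
      unfolding integral_distr[OF s borel_measurable_fst] integral_distr[OF s y2] using g0
      by (simp_all add: prob_space)
    moreover have "(\<integral>z. fst z \<partial>\<gamma>0) = (\<integral>s. fst s \<partial>\<mu>13)" "(\<integral>z. fst (snd z) \<partial>\<gamma>0) = (\<integral>s. fst s \<partial>\<mu>23)"
      using g0 mean(1)[OF int1] mean(1)[OF int2] by auto
    ultimately have "ereal ((\<integral>s. fst s \<partial>\<mu>23) + e2 - ((\<integral>s. fst s \<partial>\<mu>13) + e1)) \<le> ?I"
      by (simp add: val)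
    then show ?thesis
      by (simp add: e1_def e2_def inner_diff_left algebra_simps)
  qed
  show ?thesis unfolding B1_def[symmetric] B2_def[symmetric]
  proof (rule antisym)
    show "?I \<le> ereal (?E + shift_value d1 d2)"
      unfolding overlap_primal_def by (rule SUP_least[OF upper])
    show "ereal (?E + shift_value d1 d2) \<le> ?I"
    \<comment> \<open>The supremum is an extended real: the zero displacement excludes
      \<open>-\<infinity>\<close>, and \<open>\<infinity>\<close> makes the inequality
      trivial.\<close>
    proof (cases ?I)
      case (real r)
      have "shift_value d1 d2 \<le> r - ?E"
        using lower unfolding real by (intro shift_value_le[OF d]) (simp add: algebra_simps)
      then show ?thesis unfolding real by simp
    next
      case MInf
      then show ?thesis using lower[OF feasible_0[OF d]] by simp
    qed simp
  qed
qed

text \<open>The objective depends only on the two marginal means, and each can move by at most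
  \<open>sqrt (blk_YY V) * sqrt d\<close>. The law \<open>\<gamma>0\<close> is merely some coupling
  of the marginals to be translated.\<close>

lemma nonoverlap_primal_eq:
  fixes \<gamma>0 :: "(real \<times> real) measure"
    and V1 V2 :: "real ^ (unit + 'q) ^ (unit + 'q::finite)"
  assumes \<gamma>0: "\<gamma>0 \<in> borel_probs" and m1: "distr \<gamma>0 borel fst = \<mu>1" and m2: "distr \<gamma>0 borel snd = \<mu>2"
    and int1: "integrable \<mu>1 (\<lambda>s. s)" and int2: "integrable \<mu>2 (\<lambda>s. s)"
    and V1: "positive_definite V1" and V2: "positive_definite V2"
    and d: "0 \<le> d1" "0 \<le> d2"
  shows "nonoverlap_primal (\<lambda>y1 y2. y2 - y1) (mahalanobis_cost_Y V1) (mahalanobis_cost_Y V2) \<mu>1 \<mu>2 (d1, d2) =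
    ereal ((\<integral>s. s \<partial>\<mu>2) - (\<integral>s. s \<partial>\<mu>1) + sqrt (blk_YY V1) * sqrt d1 + sqrt (blk_YY V2) * sqrt d2)"
    (is "?I = ereal ?v")
proof (rule antisym)
  let ?f = "\<lambda>(y1, y2). y2 - y1 :: real"
  let ?A = "nonoverlap_ambiguity (mahalanobis_cost_Y V1) (mahalanobis_cost_Y V2) \<mu>1 \<mu>2 (d1, d2)"
  have marg: "integrable \<gamma> fst \<and> integrable \<gamma> snd \<and>
      (\<integral>s. s \<partial>distr \<gamma> borel fst) = (\<integral>z. fst z \<partial>\<gamma>) \<and> (\<integral>s. s \<partial>distr \<gamma> borel snd) = (\<integral>z. snd z \<partial>\<gamma>)"
    if \<gamma>: "\<gamma> \<in> borel_probs"
      and i: "integrable (distr \<gamma> borel fst) (\<lambda>s. s)" "integrable (distr \<gamma> borel snd) (\<lambda>s. s)"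
    for \<gamma> :: "(real \<times> real) measure"
    using i
    unfolding integrable_distr_eq[OF borel_probs_measurable[OF \<gamma> borel_measurable_fst] borel_measurable_ident]
      integrable_distr_eq[OF borel_probs_measurable[OF \<gamma> borel_measurable_snd] borel_measurable_ident]
      integral_distr[OF borel_probs_measurable[OF \<gamma> borel_measurable_fst] borel_measurable_ident]
      integral_distr[OF borel_probs_measurable[OF \<gamma> borel_measurable_snd] borel_measurable_ident]
    by simp
  have val: "ext_integral \<gamma> ?f = ereal ((\<integral>z. snd z \<partial>\<gamma>) - (\<integral>z. fst z \<partial>\<gamma>))"
    if "integrable \<gamma> fst" "integrable \<gamma> snd" for \<gamma> :: "(real \<times> real) measure"
    using that by (simp add: ext_integral_eq_lebesgue_integral case_prod_unfold)
  show "?I \<le> ereal ?v"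
    unfolding nonoverlap_primal_def
  proof (rule SUP_least)
    fix \<gamma> assume \<gamma>: "\<gamma> \<in> ?A"
    have \<gamma>p: "\<gamma> \<in> borel_probs" and t1: "transport_cost (mahalanobis_cost_Y V1) \<mu>1 (distr \<gamma> borel fst) \<le> ennreal d1"
      and t2: "transport_cost (mahalanobis_cost_Y V2) \<mu>2 (distr \<gamma> borel snd) \<le> ennreal d2"
      using \<gamma> by (auto simp: nonoverlap_ambiguity_def)
    have p: "\<mu>1 \<in> borel_probs" "\<mu>2 \<in> borel_probs"
      using borel_probs_distr[OF \<gamma>0 borel_measurable_fst] borel_probs_distr[OF \<gamma>0 borel_measurable_snd] m1 m2 by auto
    note n1 = mahalanobis_Y_transport_mean[OF V1 p(1) int1 t1 d(1)]
    note n2 = mahalanobis_Y_transport_mean[OF V2 p(2) int2 t2 d(2)]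
    note g = marg[OF \<gamma>p n1(1) n2(1)]
    show "ext_integral \<gamma> ?f \<le> ereal ?v" using val n1(2) n2(2) g by simp
  qed
  interpret prob_space \<gamma>0 using \<gamma>0 by (simp add: borel_probs_def)
  \<comment> \<open>Each shift spends its whole budget: \<open>y1\<close> moves down and
    \<open>y2\<close> moves up.\<close>
  define e1 e2 where "e1 = - (sqrt (blk_YY V1) * sqrt d1)" and "e2 = sqrt (blk_YY V2) * sqrt d2"
  note g0 = marg[OF \<gamma>0, unfolded m1 m2, OF int1 int2]
  let ?s = "\<lambda>z. z + (e1, e2)"
  have s0: "?s \<in> borel_measurable borel" by (rule borel_measurable_translation)
  note s = borel_probs_measurable[OF \<gamma>0 s0]
  let ?\<gamma> = "distr \<gamma>0 borel ?s"
  have "distr ?\<gamma> borel fst = distr \<mu>1 borel (\<lambda>y. y + e1)"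
    unfolding m1[symmetric] distr_distr_borel_probs[OF \<gamma>0 s0 borel_measurable_fst]
      distr_distr_borel_probs[OF \<gamma>0 borel_measurable_fst borel_measurable_translation]
    by simp
  moreover have "distr ?\<gamma> borel snd = distr \<mu>2 borel (\<lambda>y. y + e2)"
    unfolding m2[symmetric] distr_distr_borel_probs[OF \<gamma>0 s0 borel_measurable_snd]
      distr_distr_borel_probs[OF \<gamma>0 borel_measurable_snd borel_measurable_translation]
    by simp
  moreover have cost: "transport_cost (mahalanobis_cost_Y V) \<mu> (distr \<mu> borel (\<lambda>y. y + e)) \<le> ennreal d"
    if "positive_definite V" "\<mu> \<in> borel_probs" "0 \<le> d" "e\<^sup>2 = blk_YY V * d"
    for V :: "real ^ (unit + 'q) ^ (unit + 'q::finite)" and \<mu> e d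
  proof (rule transport_cost_translation[OF that(2)])
    show "mahalanobis_cost_Y V y (y + e) \<le> d" for y
      using that(4) blk_YY_pos[OF that(1)] by (simp add: mahalanobis_cost_Y_def field_simps power2_eq_square)
    show "(\<lambda>z. mahalanobis_cost_Y V (fst z) (snd z)) \<in> borel_measurable borel"
      unfolding mahalanobis_cost_Y_def by (intro borel_measurable_continuous_onI continuous_intros)
  qed
  moreover have "e1\<^sup>2 = blk_YY V1 * d1" "e2\<^sup>2 = blk_YY V2 * d2"
    using d blk_YY_pos[OF V1] blk_YY_pos[OF V2] by (simp_all add: e1_def e2_def power_mult_distrib)
  ultimately have "?\<gamma> \<in> ?A"
    using borel_probs_distr[OF \<gamma>0 s0] cost[OF V1 _ d(1)] cost[OF V2 _ d(2)]
      borel_probs_distr[OF \<gamma>0 borel_measurable_fst] borel_probs_distr[OF \<gamma>0 borel_measurable_snd]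
    by (simp add: nonoverlap_ambiguity_def m1 m2)
  then have "ext_integral ?\<gamma> ?f \<le> ?I"
    unfolding nonoverlap_primal_def by (rule SUP_upper)
  moreover have "integrable ?\<gamma> fst" "integrable ?\<gamma> snd"
    using g0 by (auto simp: integrable_distr_eq[OF s] borel_measurable_fst borel_measurable_snd)
  moreover have "(\<integral>z. fst z \<partial>?\<gamma>) = (\<integral>z. fst z \<partial>\<gamma>0) + e1" "(\<integral>z. snd z \<partial>?\<gamma>) = (\<integral>z. snd z \<partial>\<gamma>0) + e2"
    using g0 by (auto simp: integral_distr[OF s] borel_measurable_fst borel_measurable_snd prob_space)
  ultimately have "ereal ((\<integral>z. snd z \<partial>\<gamma>0) + e2 - ((\<integral>z. fst z \<partial>\<gamma>0) + e1)) \<le> ?I"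
    by (simp add: val)
  then show "ereal ?v \<le> ?I"
    using g0 by (simp add: e1_def e2_def algebra_simps)
qed

section \<open>Closed formulas, equality criterion and continuity\<close>

theorem proposition6p3:
  fixes \<mu>13 \<mu>23 :: "(real \<times> (real ^ 'q::finite)) measure"
    and V1 V2 :: "real ^ (unit + 'q) ^ (unit + 'q)"
  assumes "\<mu>13 \<in> borel_probs" and "\<mu>23 \<in> borel_probs"
    and "distr \<mu>13 borel snd = distr \<mu>23 borel snd"
    and "integrable \<mu>13 (\<lambda>(y, x). (norm x)\<^sup>2)"
    and "integrable \<mu>13 (\<lambda>(y, x). \<bar>y\<bar>\<^sup>2)"
    and "integrable \<mu>23 (\<lambda>(y, x). \<bar>y\<bar>\<^sup>2)"
    and "positive_definite V1" and "positive_definite V2"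
  shows
    "let f = (\<lambda>y1 y2. y2 - y1);
         I = overlap_primal f (mahalanobis_cost V1) (mahalanobis_cost V2) \<mu>13 \<mu>23;
         I\<^sub>D = nonoverlap_primal f (mahalanobis_cost_Y V1) (mahalanobis_cost_Y V2)
                (distr \<mu>13 borel fst) (distr \<mu>23 borel fst);
         EY1 = (\<integral>s. fst s \<partial>\<mu>13);
         EY2 = (\<integral>s. fst s \<partial>\<mu>23);
         Vo = matrix_inv (blk_XX V2) *v blk_XY V2 - matrix_inv (blk_XX V1) *v blk_XY V1
     in
       (\<forall>\<delta>1 \<ge> 0. \<forall>\<delta>2 \<ge> 0.
          I\<^sub>D (\<delta>1, \<delta>2) =
            ereal (EY2 - EY1 + sqrt (blk_YY V1) * sqrt \<delta>1 + sqrt (blk_YY V2) * sqrt \<delta>2) \<and>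
          I (\<delta>1, \<delta>2) =
            ereal (EY2 - EY1) +
            (INF (l1, l2) \<in> {0<..} \<times> {0<..}. ereal (
               l1 * \<delta>1 + l2 * \<delta>2 + 1 / (4 * l1) * schur_XX V1 + 1 / (4 * l2) * schur_XX V2 +
               1 / 4 * (Vo \<bullet> (matrix_inv (l1 *\<^sub>R matrix_inv (blk_XX V1) +
                                         l2 *\<^sub>R matrix_inv (blk_XX V2)) *v Vo))))) \<and>
       ((\<forall>\<delta>1 \<ge> 0. \<forall>\<delta>2 \<ge> 0. I\<^sub>D (\<delta>1, \<delta>2) = I (\<delta>1, \<delta>2)) \<longleftrightarrow> blk_XY V1 = 0 \<and> blk_XY V2 = 0) \<and>
       continuous_on ({0..} \<times> {0..}) I\<^sub>D \<and> continuous_on ({0..} \<times> {0..}) I"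
proof -
  note \<mu>13 = assms(1) and \<mu>23 = assms(2) and eq = assms(3) and V1 = assms(7) and V2 = assms(8)
  define A1 A2 where "A1 = matrix_inv (blk_XX V1)" and "A2 = matrix_inv (blk_XX V2)"
  define Vo where "Vo = A2 *v blk_XY V2 - A1 *v blk_XY V1"
  define E where "E = (\<integral>s. fst s \<partial>\<mu>23) - (\<integral>s. fst s \<partial>\<mu>13)"
  define I where "I = overlap_primal (\<lambda>y1 y2. y2 - y1) (mahalanobis_cost V1) (mahalanobis_cost V2) \<mu>13 \<mu>23"
  define J where "J = nonoverlap_primal (\<lambda>y1 y2. y2 - y1) (mahalanobis_cost_Y V1) (mahalanobis_cost_Y V2)
    (distr \<mu>13 borel fst) (distr \<mu>23 borel fst)"
  interpret \<mu>13: prob_space \<mu>13 using \<mu>13 by (simp add: borel_probs_def)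
  interpret \<mu>23: prob_space \<mu>23 using \<mu>23 by (simp add: borel_probs_def)
  have A: "positive_definite A1" "positive_definite A2"
    unfolding A1_def A2_def by (intro positive_definite_matrix_inv positive_definite_blk_XX V1 V2)+
  interpret shift_problem A1 A2 "schur_XX V1" "schur_XX V2" Vo
    by unfold_locales (intro A schur_XX_pos V1 V2)+
  note m13 = borel_probs_measurable[OF \<mu>13 borel_measurable_fst] borel_probs_measurable[OF \<mu>13 borel_measurable_snd]
  note m23 = borel_probs_measurable[OF \<mu>23 borel_measurable_fst] borel_probs_measurable[OF \<mu>23 borel_measurable_snd]
  have y1: "integrable \<mu>13 fst" and x1: "integrable \<mu>13 snd"
    using \<mu>13.integrable_of_integrable_norm_square[OF m13(1)] \<mu>13.integrable_of_integrable_norm_square[OF m13(2)]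
      assms(4,5) by (simp_all add: case_prod_unfold)
  have y2: "integrable \<mu>23 fst"
    using \<mu>23.integrable_of_integrable_norm_square[OF m23(1)] assms(6) by (simp add: case_prod_unfold)
  \<comment> \<open>The moment of \<open>x\<close> is given under \<open>\<mu>13\<close> and reaches
    \<open>\<mu>23\<close> through the common marginal.\<close>
  have "integrable (distr \<mu>13 borel snd) (\<lambda>x. x)" using x1 unfolding integrable_distr_eq[OF m13(2) borel_measurable_ident] .
  then have x2: "integrable \<mu>23 snd" unfolding eq integrable_distr_eq[OF m23(2) borel_measurable_ident] .
  have int: "integrable \<mu>13 (\<lambda>s. s)" "integrable \<mu>23 (\<lambda>s. s)"
    using integrable_Pair_iff[of \<mu>13 fst snd] integrable_Pair_iff[of \<mu>23 fst snd] y1 x1 y2 x2 by simp_all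
  have I: "I (d1, d2) = ereal (E + shift_value d1 d2)" if "0 \<le> d1" "0 \<le> d2" for d1 d2
    unfolding I_def E_def Vo_def A1_def A2_def
    by (rule overlap_primal_eq_shift_value[OF \<mu>13 \<mu>23 eq int V1 V2 that])
  have J: "J (d1, d2) = ereal (E + sqrt (blk_YY V1) * sqrt d1 + sqrt (blk_YY V2) * sqrt d2)"
    if "0 \<le> d1" "0 \<le> d2" for d1 d2
  proof -
    obtain \<gamma> :: "(real \<times> real \<times> (real ^ 'q)) measure" where \<gamma>: "\<gamma> \<in> borel_probs"
      and \<gamma>1: "distr \<gamma> borel (\<lambda>(y1, y2, x). (y1, x)) = \<mu>13" and \<gamma>2: "distr \<gamma> borel (\<lambda>(y1, y2, x). (y2, x)) = \<mu>23"
      using gluing[OF \<mu>13 \<mu>23 eq] by blast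
    let ?g = "\<lambda>z :: real \<times> real \<times> (real ^ 'q). (fst z, fst (snd z))"
    have g: "?g \<in> borel_measurable borel" by (intro borel_measurable_continuous_onI continuous_intros)
    have "distr (distr \<gamma> borel ?g) borel fst = distr \<mu>13 borel fst"
      unfolding \<gamma>1[symmetric] distr_distr_borel_probs[OF \<gamma> g borel_measurable_fst]
        distr_distr_borel_probs[OF \<gamma> borel_measurable_y1x borel_measurable_fst]
      by (simp add: case_prod_unfold)
    moreover have "distr (distr \<gamma> borel ?g) borel snd = distr \<mu>23 borel fst"
      unfolding \<gamma>2[symmetric] distr_distr_borel_probs[OF \<gamma> g borel_measurable_snd]
        distr_distr_borel_probs[OF \<gamma> borel_measurable_y2x borel_measurable_fst]
      by (simp add: case_prod_unfold)
    ultimately show ?thesis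
      unfolding J_def E_def
      using nonoverlap_primal_eq[OF borel_probs_distr[OF \<gamma> g] _ _ _ _ V1 V2 that] y1 y2
      by (simp add: integrable_distr_eq integral_distr m13 m23)
  qed
  have inf: "I (d1, d2) = ereal E + (INF (l1, l2) \<in> {0<..} \<times> {0<..}. ereal (dual l1 l2 d1 d2))"
    if "0 \<le> d1" "0 \<le> d2" for d1 d2
    by (simp add: I[OF that] flip: strong_duality[OF that])
  have cont: "continuous_on ({0..} \<times> {0..}) J" "continuous_on ({0..} \<times> {0..}) I"
  proof -
    have "continuous_on ({0..} \<times> {0..})
        (\<lambda>d. ereal (E + sqrt (blk_YY V1) * sqrt (fst d) + sqrt (blk_YY V2) * sqrt (snd d)))"
      by (intro continuous_intros)
    then show "continuous_on ({0..} \<times> {0..}) J"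
      by (rule continuous_on_cong[THEN iffD1, rotated 2]) (auto simp: J)
    have "continuous_on ({0..} \<times> {0..}) (\<lambda>d. ereal (E + shift_value (fst d) (snd d)))"
      by (intro continuous_intros continuous_on_shift_value)
    then show "continuous_on ({0..} \<times> {0..}) I"
      by (rule continuous_on_cong[THEN iffD1, rotated 2]) (auto simp: I)
  qed
  obtain c where "0 < c" and upper: "\<And>d1 d2. 0 \<le> d1 \<Longrightarrow> 0 \<le> d2 \<Longrightarrow> shift_value d1 d2 \<le>
      sqrt (schur_XX V1) * sqrt d1 + sqrt (schur_XX V2) * sqrt d2 + norm Vo * sqrt (min d1 d2 / c)"
    by (rule shift_value_upper) (rule that, simp_all)
  have schur: "schur_XX V = blk_YY V - blk_XY V \<bullet> (matrix_inv (blk_XX V) *v blk_XY V)"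
    if "positive_definite V" for V :: "real ^ (unit + 'q) ^ (unit + 'q)"
    using symmetric_blk_YX_eq_blk_XY[OF positive_definite_imp_symmetric[OF that]] by (simp add: schur_XX_def)
  have iff: "(\<forall>d1 \<ge> 0. \<forall>d2 \<ge> 0. J (d1, d2) = I (d1, d2)) \<longleftrightarrow> blk_XY V1 = 0 \<and> blk_XY V2 = 0"
  proof
    assume eq: "\<forall>d1 \<ge> 0. \<forall>d2 \<ge> 0. J (d1, d2) = I (d1, d2)"
    \<comment> \<open>At radii \<open>(1, 0)\<close> the smaller radius is zero, so the term with
      \<open>Vo\<close> drops out of \<open>upper\<close>. Equality then leaves no room for the form
      that the Schur complement subtracts from \<open>blk_YY V1\<close>.\<close>
    have "sqrt (blk_YY V1) \<le> sqrt (schur_XX V1)" using upper[of 1 0] I[of 1 0] J[of 1 0] eq by simp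
    then have "blk_XY V1 \<bullet> (A1 *v blk_XY V1) \<le> 0" by (simp add: schur[OF V1] A1_def)
    then have "blk_XY V1 = 0" using positive_definite_pos[OF A(1)] by (meson not_le)
    have "sqrt (blk_YY V2) \<le> sqrt (schur_XX V2)" using upper[of 0 1] I[of 0 1] J[of 0 1] eq by simp
    then have "blk_XY V2 \<bullet> (A2 *v blk_XY V2) \<le> 0" by (simp add: schur[OF V2] A2_def)
    then have "blk_XY V2 = 0" using positive_definite_pos[OF A(2)] by (meson not_le)
    with \<open>blk_XY V1 = 0\<close> show "blk_XY V1 = 0 \<and> blk_XY V2 = 0" ..
  next
    assume XY: "blk_XY V1 = 0 \<and> blk_XY V2 = 0"
    \<comment> \<open>Without cross blocks \<open>Vo = 0\<close>, and the upper and lower bounds on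
      the value coincide at all radii.\<close>
    then have "schur_XX V1 = blk_YY V1" "schur_XX V2 = blk_YY V2" "Vo = 0"
      by (simp_all add: schur V1 V2 Vo_def)
    then have "shift_value d1 d2 = sqrt (blk_YY V1) * sqrt d1 + sqrt (blk_YY V2) * sqrt d2"
      if "0 \<le> d1" "0 \<le> d2" for d1 d2
      using upper[OF that] shift_value_ge[OF that] by simp
    then show "\<forall>d1 \<ge> 0. \<forall>d2 \<ge> 0. J (d1, d2) = I (d1, d2)" by (simp add: I J)
  qed
  show ?thesis
    unfolding Let_def I_def[symmetric] J_def[symmetric] A1_def[symmetric] A2_def[symmetric] Vo_def[symmetric]
      E_def[symmetric] dual_def[symmetric]
    by (intro conjI allI impI inf J cont iff)
qed

end
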